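(* Let $\mathcal{G}$ be a directed graph with edge lengths $\ell$ satisfying assumptions (G1), (G2), (G3) (listed in the context), and fix a vertex $v\in V$. Suppose $c_1,\dots,c_n$ are $n$ costs on the edges, with vector of costs $\overline{c}=(c_1,\dots,c_n):\mathcal{E}\to\mathbb{R}^n_{\ge 0}$. Then there exists a vector $\Lambda(\overline{c})\in\mathbb{R}^n_{>0}$ such that for any $\epsilon>0$ $$\lim_{T\to\infty}\frac1T\log\left(\mu_T\left\{p\in\mathcal{P}_v:\left\|\frac{\overline{c}(p)}{T}-\Lambda(\overline{c})\right\|>\epsilon\right\}\right)<0 .$$ Here $\|\cdot\|$ is any norm on $\mathbb{R}^n$.
   Context: $\mathcal{G}$ is a directed graph with countable vertex set $V$ and countable edge set $\mathcal{E}$; each edge $e\in\mathcal{E}$ is labelled with a length $\ell(e)$. The length $\ell(p)$ of a path $p$ is the sum of the lengths of its edges. Assumptions: (G1) for all $\sigma>0$, $\sum_{e\in\mathcal{E}}e^{-\sigma\ell(e)}<\infty$; (G2) there is a constant $C>0$ such that for each $e,e'\in\mathcal{E}$ there is a path in $\mathcal{G}$ of length less than $C+\ell(e)+\ell(e')$ which starts with $e$ and ends with $e'$; (G3) there does not exist $d>0$ such that $\{\ell(p):p\text{ is a closed path in }\mathcal{G}\}\subset d\mathbb{N}$. A cost on the edges is a non-zero function $c:\mathcal{E}\to\mathbb{R}$ for which there is a constant $C>0$ with $|c(e)|\le C\ell(e)$ for all $e\in\mathcal{E}$; it extends to paths by summing over the edges of the path. For $n$ costs $c_1,\dots,c_n$,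 the vector of costs is $\overline{c}:\mathcal{E}\to\mathbb{R}^n_{\ge 0}$, $\overline{c}(e)=(c_1(e),\dots,c_n(e))$, and $\overline{c}(p)=(c_1(p),\dots,c_n(p))$ for a path $p$. $\mathcal{P}_v$ is the set of all closed paths in $\mathcal{G}$ starting with the vertex $v$, $\mathcal{P}_v(T)=\{p\in\mathcal{P}_v:\ell(p)<T\}$, and $\mu_T$ is the uniform counting probability measure on $\mathcal{P}_v(T)$: $\mu_T(E)=\#(E\cap\mathcal{P}_v(T))/\#\mathcal{P}_v(T)$ for $E\subset\mathcal{P}_v$. *)

theory Defs
  imports
    "HOL-Analysis.Analysis"
    "Graph_Theory.Weighted_Graph"
begin

text \<open>
  Graphs are the (possibly infinite) multi-digraphs of \<^locale>\<open>wf_digraph\<close>; paths are the arc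
  lists \<^const>\<open>pre_digraph.awalk\<close>, in which vertices and edges may repeat. Lengths and costs
  extend to paths by \<^const>\<open>wf_digraph.awalk_cost\<close>, the sum over the edges of the path.
\<close>

definition G1 :: "('v, 'e) pre_digraph \<Rightarrow> ('e \<Rightarrow> real) \<Rightarrow> bool" where
  "G1 G l \<longleftrightarrow> (\<forall>\<sigma>>0. (\<lambda>e. exp (- \<sigma> * l e)) summable_on arcs G)"

definition G2 :: "('v, 'e) pre_digraph \<Rightarrow> ('e \<Rightarrow> real) \<Rightarrow> bool" where
  "G2 G l \<longleftrightarrow> (\<exists>C>0. \<forall>e\<in>arcs G. \<forall>e'\<in>arcs G.
     \<exists>u p w. pre_digraph.awalk G u p w \<and> p \<noteq> [] \<and> hd p = e \<and> last p = e' \<and>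
             wf_digraph.awalk_cost l p < C + l e + l e')"

definition G3 :: "('v, 'e) pre_digraph \<Rightarrow> ('e \<Rightarrow> real) \<Rightarrow> bool" where
  "G3 G l \<longleftrightarrow> \<not> (\<exists>d>0. {wf_digraph.awalk_cost l p | p. wf_digraph.closed_w G p}
                        \<subseteq> {d * real k | k. True})"

definition is_cost :: "('v, 'e) pre_digraph \<Rightarrow> ('e \<Rightarrow> real) \<Rightarrow> ('e \<Rightarrow> real) \<Rightarrow> bool" where
  "is_cost G l c \<longleftrightarrow> (\<exists>e\<in>arcs G. c e \<noteq> 0) \<and> (\<exists>C>0. \<forall>e\<in>arcs G. \<bar>c e\<bar> \<le> C * l e)"

definition cost_vec :: "('n::finite \<Rightarrow> 'e \<Rightarrow> real) \<Rightarrow> 'e list \<Rightarrow> real ^ 'n" where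
  "cost_vec c p = (\<chi> i. wf_digraph.awalk_cost (c i) p)"

text \<open>
  As in \<^const>\<open>wf_digraph.closed_w\<close>, closed paths have at least one edge. A vertex without
  incident edges therefore has no closed paths.
\<close>

definition closed_paths :: "('v, 'e) pre_digraph \<Rightarrow> 'v \<Rightarrow> 'e list set" where
  "closed_paths G v = {p. pre_digraph.awalk G v p v \<and> p \<noteq> []}"

definition closed_paths_below ::
    "('v, 'e) pre_digraph \<Rightarrow> ('e \<Rightarrow> real) \<Rightarrow> 'v \<Rightarrow> real \<Rightarrow> 'e list set" where
  "closed_paths_below G l v T = {p \<in> closed_paths G v. wf_digraph.awalk_cost l p < T}"

definition path_measure ::
    "('v, 'e) pre_digraph \<Rightarrow> ('e \<Rightarrow> real) \<Rightarrow> 'v \<Rightarrow> real \<Rightarrow> 'e list set \<Rightarrow> real" where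
  "path_measure G l v T E =
     real (card (E \<inter> closed_paths_below G l v T)) / real (card (closed_paths_below G l v T))"

definition is_norm :: "('a::real_vector \<Rightarrow> real) \<Rightarrow> bool" where
  "is_norm N \<longleftrightarrow> (\<forall>x. 0 \<le> N x) \<and> (\<forall>x. N x = 0 \<longleftrightarrow> x = 0) \<and>
     (\<forall>a x. N (a *\<^sub>R x) = \<bar>a\<bar> * N x) \<and> (\<forall>x y. N (x + y) \<le> N x + N y)"

text \<open>
  The extended-real logarithm, with value \<open>-\<infinity>\<close> at 0: a deviation set may be empty (for instance,
  for large \<open>\<epsilon>\<close>), whereas \<^const>\<open>ln\<close> has the value 0 at 0.
\<close>

definition elog :: "real \<Rightarrow> ereal" where
  "elog x = (if x \<le> 0 then -\<infinity> else ereal (ln x))"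

end

theory Submission
  imports Defs
begin

text \<open>
  Let \<open>P\<close> be the set of closed paths at \<open>v\<close>. Concatenation in \<open>P\<close> shows that the number \<open>W m\<close> of
  \<open>p \<in> P\<close> with edge counts \<open>m\<close> satisfies \<open>W m ^ k \<le> W (k m)\<close>, and by \<open>G1\<close> only subexponentially
  many multisets \<open>m\<close> occur below length \<open>T\<close>. Hence for every open \<open>U\<close> the number of \<open>p \<in> P\<close> with
  \<open>l(p) < T\<close> and \<open>c(p)/T \<in> U\<close> has an exact exponential growth rate, the supremum of \<open>ln (W m) / T\<close>
  over the admissible pairs; this is where existence of the limit comes from. Let \<open>h\<close> be the rate
  for the whole space. Then \<open>h > 0\<close> by \<open>G3\<close>, and the first return paths \<open>R\<close>, which freely generate
  \<open>P\<close>, satisfy \<open>\<Sum>\<^bsub>r \<in> R\<^esub> exp (- h l(r)) \<le> 1\<close>.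

  By \<open>G2\<close>, all paths that avoid \<open>v\<close> in their interior extend boundedly to elements of \<open>R\<close>, so their
  weights \<open>exp (- h l(p))\<close> have a finite sum too. Some level (number of edges) then has total
  weight below 1, and this persists for some \<open>s < h\<close>; cutting paths into blocks of that level gives
  \<open>\<Sum>\<^bsub>r \<in> R\<^esub> exp (- s l(r)) < \<infinity>\<close>. Such a spectral gap makes \<open>exp (- h l + \<theta> b)\<close> summable over \<open>R\<close>
  with sum below 1, for small \<open>\<theta> > 0\<close> and any cost \<open>b\<close> of negative weighted mean, whence a Chernoff bound
  on \<open>P\<close>. The vector \<open>\<Lambda>\<close> is the ratio of the weighted means of \<open>c\<close> and \<open>l\<close> over \<open>R\<close>.
\<close>

section \<open>Bounds for sums of nonnegative families\<close>

text \<open>Bounding all finite partial sums replaces \<open>infsum\<close> wherever only an upper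
  estimate matters: for nonnegative \<open>f\<close> it yields summability and a bound on the sum at
  once.\<close>

definition sum_le :: "('a \<Rightarrow> real) \<Rightarrow> 'a set \<Rightarrow> real \<Rightarrow> bool" where
  "sum_le f A B \<longleftrightarrow> (\<forall>F. finite F \<longrightarrow> F \<subseteq> A \<longrightarrow> sum f F \<le> B)"

lemma sum_leI: "(\<And>F. finite F \<Longrightarrow> F \<subseteq> A \<Longrightarrow> sum f F \<le> B) \<Longrightarrow> sum_le f A B"
  by (simp add: sum_le_def)

lemma sum_leD: "sum_le f A B \<Longrightarrow> finite F \<Longrightarrow> F \<subseteq> A \<Longrightarrow> sum f F \<le> B"
  by (simp add: sum_le_def)

lemma sum_le_subset: "sum_le f A B \<Longrightarrow> A' \<subseteq> A \<Longrightarrow> sum_le f A' B"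
  by (auto simp: sum_le_def)

lemma sum_le_singleton:
  assumes "0 \<le> f x" "f x \<le> B"
  shows "sum_le f {x} B"
proof (rule sum_leI)
  fix F assume "F \<subseteq> {x}"
  then have "F = {} \<or> F = {x}" by blast
  then show "sum f F \<le> B" using assms by (elim disjE) simp_all
qed

lemma sum_le_nonneg: "sum_le f A B \<Longrightarrow> 0 \<le> B"
  using sum_leD[of f A B "{}"] by simp

lemma sum_le_point: "sum_le f A B \<Longrightarrow> x \<in> A \<Longrightarrow> f x \<le> B"
  using sum_leD[of f A B "{x}"] by simp

lemma sum_le_weaken: "sum_le f A B \<Longrightarrow> B \<le> B' \<Longrightarrow> sum_le f A B'"
  by (fastforce simp: sum_le_def)

text \<open>The main comparison principle: an injective encoding of \<open>A\<close> into an index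
  set with a known bound transfers that bound, \<open>K\<close> absorbing a bounded distortion of
  the weights. Path sums are estimated by encoding paths this way.\<close>

lemma sum_le_inj:
  assumes "sum_le g A' B" "inj_on h A" "h ` A \<subseteq> A'" "\<And>x. x \<in> A \<Longrightarrow> f x \<le> K * g (h x)" "0 \<le> K"
  shows "sum_le f A (K * B)"
proof (rule sum_leI)
  fix F assume F: "finite F" "F \<subseteq> A"
  have "sum f F \<le> (\<Sum>x\<in>F. K * g (h x))" using F assms(4) by (intro sum_mono) auto
  also have "\<dots> = K * sum g (h ` F)"
    using inj_on_subset[OF assms(2) F(2)] by (simp add: sum.reindex sum_distrib_left)
  also have "\<dots> \<le> K * B"
    using F assms(1,3,5) by (intro mult_left_mono sum_leD[OF assms(1)]) auto
  finally show "sum f F \<le> K * B" .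
qed

lemma sum_le_dominated:
  assumes "sum_le g A B" "\<And>x. x \<in> A \<Longrightarrow> f x \<le> K * g x" "0 \<le> K"
  shows "sum_le f A (K * B)"
  using sum_le_inj[OF assms(1), of id A f K] assms by auto

lemma sum_le_add:
  assumes "sum_le f A a" "sum_le g A b"
  shows "sum_le (\<lambda>x. f x + g x) A (a + b)"
  by (rule sum_leI) (simp add: sum.distrib add_mono sum_leD[OF assms(1)] sum_leD[OF assms(2)])

lemma sum_le_Times:
  assumes "sum_le f A a" "sum_le g B b" "\<And>x. x \<in> A \<Longrightarrow> 0 \<le> f x" "\<And>y. y \<in> B \<Longrightarrow> 0 \<le> g y"
  shows "sum_le (\<lambda>(x, y). f x * g y) (A \<times> B) (a * b)"
proof (rule sum_leI)
  fix F assume F: "finite F" "F \<subseteq> A \<times> B"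
  have "(\<Sum>(x, y)\<in>F. f x * g y) \<le> (\<Sum>(x, y)\<in>fst ` F \<times> snd ` F. f x * g y)"
    using F assms(3,4) by (intro sum_mono2) (force+)
  also have "\<dots> = sum f (fst ` F) * sum g (snd ` F)"
    by (simp add: sum_product sum.cartesian_product)
  also have "\<dots> \<le> a * b"
    using F assms by (intro mult_mono sum_leD[OF assms(1)] sum_leD[OF assms(2)] sum_nonneg
        sum_le_nonneg[OF assms(1)]) (force+)
  finally show "(\<Sum>(x, y)\<in>F. f x * g y) \<le> a * b" .
qed

lemma sum_le_lists_length:
  fixes f :: "'a \<Rightarrow> real"
  assumes "sum_le (\<lambda>x. exp (f x)) A a"
  shows "sum_le (\<lambda>w. exp (sum_list (map f w))) {w. set w \<subseteq> A \<and> length w = n} (a ^ n)"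
proof (induction n)
  case 0
  show ?case
    by (rule sum_le_subset[OF sum_le_singleton[of _ "[]"]]) auto
next
  case (Suc n)
  have "sum_le (\<lambda>w. exp (sum_list (map f w))) {w. set w \<subseteq> A \<and> length w = Suc n} (1 * (a * a ^ n))"
  proof (rule sum_le_inj[OF sum_le_Times[OF assms Suc.IH]])
    let ?h = "\<lambda>w :: 'a list. (hd w, tl w)"
    show "inj_on ?h {w. set w \<subseteq> A \<and> length w = Suc n}"
      by (rule inj_onI, rule list.expand) auto
    show "?h ` {w. set w \<subseteq> A \<and> length w = Suc n} \<subseteq> A \<times> {w. set w \<subseteq> A \<and> length w = n}"
      by (auto simp: length_Suc_conv)
    show "exp (sum_list (map f w)) \<le> 1 * (case ?h w of (x, y) \<Rightarrow> exp (f x) * exp (sum_list (map f y)))"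
      if "w \<in> {w. set w \<subseteq> A \<and> length w = Suc n}" for w
      using that by (auto simp: length_Suc_conv exp_add)
  qed auto
  then show ?case by simp
qed

lemma sum_le_levels:
  fixes f :: "'a \<Rightarrow> real" and N :: "'a \<Rightarrow> nat"
  assumes "\<And>n. sum_le f {x \<in> A. N x = n} (b n)" "summable b"
  shows "sum_le f A (suminf b)"
proof (rule sum_leI)
  fix F assume F: "finite F" "F \<subseteq> A"
  have "sum f F = (\<Sum>n\<in>N ` F. sum f {x \<in> F. N x = n})"
    using F by (simp add: sum.image_gen)
  also have "\<dots> \<le> (\<Sum>n\<in>N ` F. b n)"
    using F by (intro sum_mono sum_leD[OF assms(1)]) auto
  also have "\<dots> \<le> suminf b"
    using F assms sum_le_nonneg[OF assms(1)] by (intro sum_le_suminf) auto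
  finally show "sum f F \<le> suminf b" .
qed

text \<open>Geometric series over the word length: words of length \<open>n\<close> have total
  weight at most \<open>a ^ n\<close>.\<close>

lemma sum_le_lists:
  fixes f :: "'a \<Rightarrow> real"
  assumes "sum_le (\<lambda>x. exp (f x)) A a" "a < 1"
  shows "sum_le (\<lambda>w. exp (sum_list (map f w))) {w. set w \<subseteq> A} (1 / (1 - a))"
proof -
  have a: "0 \<le> a" using sum_le_nonneg[OF assms(1)] .
  have "sum_le (\<lambda>w. exp (sum_list (map f w))) {w. set w \<subseteq> A} (suminf (\<lambda>n. a ^ n))"
    by (rule sum_le_levels[where N = length])
      (use a assms sum_le_lists_length[OF assms(1)] in \<open>auto intro: summable_geometric\<close>)
  then show ?thesis using a assms by (simp add: suminf_geometric)
qed

text \<open>Markov-type counting, by which all bounds on weighted sums become bounds on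
  cardinalities.\<close>

lemma sum_le_card:
  assumes "sum_le f A B" "\<And>x. x \<in> A \<Longrightarrow> k \<le> f x" "0 < k"
  shows "finite A" "real (card A) * k \<le> B"
proof -
  have *: "real (card F) * k \<le> B" if "finite F" "F \<subseteq> A" for F
  proof -
    have "real (card F) * k \<le> sum f F"
      using sum_bounded_below[of F k f] that assms by auto
    then show ?thesis using sum_leD[OF assms(1) that] by simp
  qed
  show "finite A"
  proof (rule ccontr)
    assume "infinite A"
    obtain n :: nat where n: "B / k < real n" using reals_Archimedean2 by blast
    obtain F where "F \<subseteq> A" "card F = n" "finite F"
      using infinite_arbitrarily_large[OF \<open>infinite A\<close>] by metis
    then show False using *[of F] n assms(3) by (simp add: field_simps)
  qed
  then show "real (card A) * k \<le> B" using * by blast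
qed

lemma sum_le_summable:
  assumes "sum_le f A B" "\<And>x. x \<in> A \<Longrightarrow> 0 \<le> f x"
  shows "f summable_on A"
  using assms by (intro nonneg_bdd_above_summable_on bdd_aboveI[of _ B]) (auto simp: sum_le_def)

lemma summable_sum_le:
  fixes f :: "'a \<Rightarrow> real"
  assumes "f summable_on A" "\<And>x. x \<in> A \<Longrightarrow> 0 \<le> f x"
  shows "sum_le f A (infsum f A)"
  using assms by (intro sum_leI finite_sum_le_infsum) auto

section \<open>Generating functions of multisets\<close>

text \<open>Euler product: a multiset over \<open>X\<close> is an independent choice of
  multiplicities, and each element contributes one geometric series. The induction splits off the
  multiplicity of one element.\<close>

lemma sum_le_multisets_finite:
  fixes f :: "'a \<Rightarrow> real"
  assumes "finite X" "\<And>e. e \<in> X \<Longrightarrow> f e < 0"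
  shows "sum_le (\<lambda>m. exp (\<Sum>e\<in>#m. f e)) {m. set_mset m \<subseteq> X} (\<Prod>e\<in>X. 1 / (1 - exp (f e)))"
  using assms
proof (induction X)
  case empty
  show ?case
    by (rule sum_le_subset[OF sum_le_singleton[of _ "{#}"]]) auto
next
  case (insert a X)
  let ?g = "\<lambda>m. exp (\<Sum>e\<in>#m. f e)"
  have x: "exp (f a) < 1" using insert.prems[of a] by simp
  have 1: "sum_le (\<lambda>k. exp (f a) ^ k) UNIV (1 / (1 - exp (f a)))"
  proof -
    have "sum_le (\<lambda>k. exp (f a) ^ k) UNIV (suminf (\<lambda>k. exp (f a) ^ k))"
      
    proof (rule sum_le_levels[where N = id])
      show "sum_le (\<lambda>k. exp (f a) ^ k) {k \<in> UNIV. id k = n} (exp (f a) ^ n)" for n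
        using sum_le_singleton[of "\<lambda>k. exp (f a) ^ k" n] by simp
      show "summable (\<lambda>k. exp (f a) ^ k)" using x by (simp add: summable_geometric)
    qed
    then show ?thesis using x by (simp add: suminf_geometric)
  qed
  have IH: "sum_le ?g {m. set_mset m \<subseteq> X} (\<Prod>e\<in>X. 1 / (1 - exp (f e)))"
    using insert by auto
  have split: "m = replicate_mset (count m a) a + filter_mset (\<lambda>e. e \<noteq> a) m" for m
    by (rule multiset_eqI) auto
  have "sum_le ?g {m. set_mset m \<subseteq> insert a X} (1 * ((1 / (1 - exp (f a))) * (\<Prod>e\<in>X. 1 / (1 - exp (f e)))))"
  proof (rule sum_le_inj[OF sum_le_Times[OF 1 IH], of "\<lambda>m. (count m a, filter_mset (\<lambda>e. e \<noteq> a) m)"])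
    show "inj_on (\<lambda>m. (count m a, filter_mset (\<lambda>e. e \<noteq> a) m)) {m. set_mset m \<subseteq> insert a X}"
      by (rule inj_onI) (metis split prod.inject)
    fix m assume "m \<in> {m. set_mset m \<subseteq> insert a X}"
    have "?g m = exp (f a) ^ count m a * ?g (filter_mset (\<lambda>e. e \<noteq> a) m)"
      by (subst split) (simp add: exp_add exp_of_nat_mult)
    then show "?g m \<le> 1 * (case (count m a, filter_mset (\<lambda>e. e \<noteq> a) m) of (x, y) \<Rightarrow> exp (f a) ^ x * ?g y)"
      by simp
  qed auto
  then show ?case using insert by simp
qed

text \<open>A finite family of multisets involves only finitely many elements, so the finite product
  applies. Since \<open>exp (f e)\<close> stays below \<open>exp (- k) < 1\<close>, each factor is
  at most \<open>exp (exp (f e) / (1 - exp (- k)))\<close>, which bounds the products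
  uniformly.\<close>

lemma sum_le_multisets:
  fixes f :: "'a \<Rightarrow> real"
  assumes "sum_le (\<lambda>e. exp (f e)) A a" "\<And>e. e \<in> A \<Longrightarrow> f e \<le> - k" "0 < k"
  shows "sum_le (\<lambda>m. exp (\<Sum>e\<in>#m. f e)) {m. set_mset m \<subseteq> A} (exp (a / (1 - exp (- k))))"
proof (rule sum_leI)
  fix F assume F: "finite F" "F \<subseteq> {m. set_mset m \<subseteq> A}"
  define X where "X = (\<Union>m\<in>F. set_mset m)"
  have X: "finite X" "X \<subseteq> A" using F by (auto simp: X_def)
  have k: "exp (- k) < 1" using assms(3) by simp
  have neg: "f e < 0" if "e \<in> X" for e using assms(2)[of e] assms(3) X that by fastforce
  have "(\<Sum>m\<in>F. exp (\<Sum>e\<in>#m. f e)) \<le> (\<Prod>e\<in>X. 1 / (1 - exp (f e)))"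
    by (rule sum_leD[OF sum_le_multisets_finite[OF X(1)]]) (use F neg in \<open>auto simp: X_def\<close>)
  also have "\<dots> \<le> (\<Prod>e\<in>X. exp (exp (f e) / (1 - exp (- k))))"
  proof (rule prod_mono, safe)
    fix e assume e: "e \<in> X"
    let ?x = "exp (f e)"
    have x: "?x \<le> exp (- k)" "?x < 1" using assms(2)[of e] X e neg by auto
    show "0 \<le> 1 / (1 - ?x)" using x by simp
    have "1 / (1 - ?x) = 1 + ?x / (1 - ?x)" using x by (simp add: field_simps)
    also have "\<dots> \<le> 1 + ?x / (1 - exp (- k))" using x k by (intro add_left_mono divide_left_mono) auto
    also have "\<dots> \<le> exp (?x / (1 - exp (- k)))" by (rule exp_ge_add_one_self)
    finally show "1 / (1 - ?x) \<le> exp (?x / (1 - exp (- k)))" .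
  qed
  also have "\<dots> = exp ((\<Sum>e\<in>X. exp (f e)) / (1 - exp (- k)))"
    using X by (simp add: exp_sum sum_divide_distrib)
  also have "\<dots> \<le> exp (a / (1 - exp (- k)))"
    using k X sum_leD[OF assms(1)] by (simp add: divide_right_mono)
  finally show "(\<Sum>m\<in>F. exp (\<Sum>e\<in>#m. f e)) \<le> exp (a / (1 - exp (- k)))" .
qed

section \<open>Counting closed paths by edge counts\<close>

text \<open>The general codomain lets one notation cover lengths, vector costs, and, as
  \<open>wt (wt f)\<close>, lists of paths.\<close>

abbreviation wt :: "('e \<Rightarrow> 'a::comm_monoid_add) \<Rightarrow> 'e list \<Rightarrow> 'a" where
  "wt f p \<equiv> sum_list (map f p)"

lemma wt_mset: "wt f p = (\<Sum>e\<in>#mset p. f e)"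
  by (metis mset_map sum_mset_sum_list)

lemma wt_concat: "wt f (concat ps) = wt (wt f) ps"
  by (induction ps) auto

lemma wt_scale: "wt (\<lambda>e. s * f e) p = s * wt f p" for s :: real
  by (induction p) (auto simp: algebra_simps)

lemma ln_le_iff_le_exp: "0 < x \<Longrightarrow> ln x \<le> y \<longleftrightarrow> x \<le> exp y" for x :: real
  by (metis exp_le_cancel_iff exp_ln)

lemma inj_on_concat_length:
  "inj_on concat {ps. set ps \<subseteq> {q. length q = n} \<and> length ps = k}"
proof (rule inj_onI, safe)
  fix ps qs :: "'a list list"
  assume "concat ps = concat qs" "set ps \<subseteq> {q. length q = n}" "set qs \<subseteq> {q. length q = n}"
    and "length qs = length ps"
  from this(4,1,2,3) show "ps = qs"
    by (induction qs ps rule: list_induct2) auto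
qed

text \<open>Some closed path at \<open>v\<close> is assumed here; a vertex without closed paths is
  treated separately in the final theorem.\<close>

locale length_graph = wf_digraph G for G :: "('v, 'e) pre_digraph" +
  fixes l :: "'e \<Rightarrow> real" and v :: 'v
  assumes l_pos: "e \<in> arcs G \<Longrightarrow> 0 < l e"
    and G1: "G1 G l" and G2: "G2 G l" and G3: "G3 G l"
    and nonempty: "closed_paths G v \<noteq> {}"
begin

abbreviation "P \<equiv> closed_paths G v"

lemma awalk_cost_wt: "awalk_cost f p = wt f p"
  by (simp add: awalk_cost_def)

lemma P_iff: "p \<in> P \<longleftrightarrow> awalk v p v \<and> p \<noteq> []"
  by (simp add: closed_paths_def)

lemma P_arcs: "p \<in> P \<Longrightarrow> set p \<subseteq> arcs G"
  by (auto simp: P_iff)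

lemma P_append: "p \<in> P \<Longrightarrow> q \<in> P \<Longrightarrow> p @ q \<in> P"
  unfolding P_iff using awalk_appendI by blast

lemma P_concat: "set ps \<subseteq> P \<Longrightarrow> ps \<noteq> [] \<Longrightarrow> concat ps \<in> P"
  by (induction ps) (fastforce intro: P_append)+

lemma wt_l_nonneg: "set p \<subseteq> arcs G \<Longrightarrow> 0 \<le> wt l p"
  using l_pos by (intro sum_list_nonneg) (auto intro: less_imp_le)

lemma wt_l_pos: "set p \<subseteq> arcs G \<Longrightarrow> p \<noteq> [] \<Longrightarrow> 0 < wt l p"
  using l_pos wt_l_nonneg by (cases p) (auto intro!: add_pos_nonneg)

lemma P_pos: "p \<in> P \<Longrightarrow> 0 < wt l p"
  by (metis P_arcs P_iff wt_l_pos)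

definition E :: "real \<Rightarrow> real" where
  "E s = (\<Sum>\<^sub>\<infinity>e\<in>arcs G. exp (- s * l e))"

lemma E: "0 < s \<Longrightarrow> sum_le (\<lambda>e. exp (- s * l e)) (arcs G) (E s)"
  using G1 unfolding E_def G1_def by (intro summable_sum_le) auto

text \<open>By \<open>G1\<close>, only finitely many edges are shorter than 1, because each of them
  contributes at least \<open>exp (- 1)\<close> to a finite sum.\<close>

lemma min_length: obtains k where "0 < k" "\<And>e. e \<in> arcs G \<Longrightarrow> k \<le> l e"
proof -
  let ?X = "{e \<in> arcs G. l e < 1}"
  have fin: "finite ?X"
    by (rule sum_le_card(1)[OF sum_le_subset[OF E[of 1]], of _ "exp (- 1)"]) auto
  define k where "k = Min (insert 1 (l ` ?X))"
  have "0 < k" using fin l_pos by (auto simp: k_def)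
  moreover have "k \<le> l e" if "e \<in> arcs G" for e
  proof (cases "l e < 1")
    case True then show ?thesis using fin that by (auto simp: k_def intro!: Min_le)
  next
    case False
    have "k \<le> 1" using fin by (auto simp: k_def intro!: Min_le)
    then show ?thesis using False by simp
  qed
  ultimately show thesis using that by blast
qed

text \<open>Raising the exponent from 1 to \<open>1 + t\<close> multiplies every term by at most
  \<open>exp (- t * k)\<close>, where \<open>k\<close> is the minimal length; \<open>t\<close> is
  taken with \<open>exp (t * k)\<close> at least \<open>2 * E 1 + 1\<close>.\<close>

lemma half_sum: obtains s where "0 < s" "sum_le (\<lambda>e. exp (- s * l e)) (arcs G) (1/2)"
proof -
  obtain k where k: "0 < k" "\<And>e. e \<in> arcs G \<Longrightarrow> k \<le> l e" using min_length by blast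
  define t where "t = max 0 (ln (2 * E 1 + 1) / k)"
  have E1: "0 \<le> E 1" using sum_le_nonneg[OF E[of 1]] by simp
  have t: "0 \<le> t" "ln (2 * E 1 + 1) \<le> t * k" using k by (auto simp: t_def field_simps max_def)
  have "2 * E 1 + 1 \<le> exp (t * k)" using t(2) E1 by (subst (asm) ln_le_iff_le_exp) (auto simp: ) 
  then have *: "exp (- t * k) * E 1 \<le> 1 / 2" by (simp add: exp_minus field_simps)
  have "sum_le (\<lambda>e. exp (- (1 + t) * l e)) (arcs G) (exp (- t * k) * E 1)"
  proof (rule sum_le_dominated[OF E[of 1]])
    fix e assume e: "e \<in> arcs G"
    have "t * k \<le> t * l e" using k(2)[OF e] t by (simp add: mult_left_mono)
    then show "exp (- (1 + t) * l e) \<le> exp (- t * k) * exp (- 1 * l e)"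
      by (simp add: mult_exp_exp algebra_simps)
  qed auto
  then have "sum_le (\<lambda>e. exp (- (1 + t) * l e)) (arcs G) (1/2)"
    using * sum_le_weaken by blast
  then show thesis using that[of "1 + t"] t by auto
qed

lemma sum_le_words:
  assumes "0 < s"
  shows "sum_le (\<lambda>w. exp (- s * wt l w)) {w. set w \<subseteq> arcs G \<and> length w = n} (E s ^ n)"
  using sum_le_lists_length[OF E[OF assms]] by (simp add: wt_scale[symmetric])

section \<open>Closed paths with the same edge counts\<close>

definition W :: "'e multiset \<Rightarrow> nat" where
  "W m = card {q \<in> P. mset q = m}"

lemma finite_W: "finite {q \<in> P. mset q = m}"
  by (rule finite_subset[OF _ finite_lists_length_eq[of "set_mset m" "size m"]]) auto

lemma W_pos: "p \<in> P \<Longrightarrow> 1 \<le> W (mset p)"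
  using finite_W[of "mset p"] card_gt_0_iff[of "{q \<in> P. mset q = mset p}"] by (auto simp: W_def Suc_le_eq)

text \<open>Concatenating \<open>k\<close> paths with edge counts \<open>m\<close> gives edge counts
  \<open>k m\<close>; all blocks have length \<open>size m\<close>, so the factors can be read
  back.\<close>

lemma W_power:
  assumes "1 \<le> k"
  shows "W m ^ k \<le> W (repeat_mset k m)"
proof -
  let ?X = "{q \<in> P. mset q = m}"
  let ?L = "{ps. set ps \<subseteq> ?X \<and> length ps = k}"
  have "W m ^ k = card ?L" using finite_W by (simp add: W_def card_lists_length_eq)
  also have "\<dots> = card (concat ` ?L)"
    by (rule card_image[symmetric], rule inj_on_subset[OF inj_on_concat_length[of "size m" k]]) auto
  also have "\<dots> \<le> W (repeat_mset k m)"
    unfolding W_def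
  proof (rule card_mono[OF finite_W], safe)
    fix ps assume ps: "set ps \<subseteq> ?X" "k = length ps"
    show "concat ps \<in> P" using ps assms by (intro P_concat) auto
    from ps(1) show "mset (concat ps) = repeat_mset (length ps) m"
      by (induction ps) auto
  qed
  finally show ?thesis .
qed

text \<open>With \<open>s\<close> from \<open>half_sum\<close>, all words of a given length have
  total weight at most 1, and all paths counted by \<open>W (mset p)\<close> have the weight of
  \<open>p\<close>. This keeps the supremum in \<open>rate\<close> finite.\<close>

lemma W_exp_bound:
  obtains s where "0 < s" "\<And>p. p \<in> P \<Longrightarrow> real (W (mset p)) \<le> exp (s * wt l p)"
proof -
  obtain s where s: "0 < s" "sum_le (\<lambda>e. exp (- s * l e)) (arcs G) (1/2)" using half_sum by blast
  have "real (W (mset p)) \<le> exp (s * wt l p)" if p: "p \<in> P" for p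
  proof -
    have 1: "sum_le (\<lambda>w. exp (wt (\<lambda>e. - s * l e) w)) {q \<in> P. mset q = mset p} ((1/2) ^ length p)"
      by (rule sum_le_subset[OF sum_le_lists_length[OF s(2)]]) (auto dest: P_arcs mset_eq_length)
    have "real (W (mset p)) * exp (- s * wt l p) \<le> (1/2) ^ length p"
      unfolding W_def
    proof (rule sum_le_card(2)[OF 1])
      fix q assume "q \<in> {q \<in> P. mset q = mset p}"
      then have "wt l q = wt l p" by (metis (mono_tags, lifting) mem_Collect_eq wt_mset)
      then show "exp (- s * wt l p) \<le> exp (wt (\<lambda>e. - s * l e) q)" by (simp add: wt_scale[of "- s", simplified])
    qed simp
    also have "\<dots> \<le> 1" by (simp add: power_le_one)
    finally show ?thesis by (simp add: exp_minus field_simps)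
  qed
  then show thesis using that s by blast
qed

section \<open>Exponential growth rates of restricted path counts\<close>

text \<open>The threshold \<open>T\<close> is recorded along with \<open>p\<close> because the cost
  is divided by \<open>T\<close>, not by the length of \<open>p\<close>. A pair can then be
  rescaled: \<open>k\<close> copies of \<open>p\<close> against the threshold
  \<open>k T\<close>.\<close>

definition adm :: "('e \<Rightarrow> 'b::real_normed_vector) \<Rightarrow> 'b set \<Rightarrow> ('e list \<times> real) set" where
  "adm c U = {(p, T). p \<in> P \<and> wt l p < T \<and> (1 / T) *\<^sub>R wt c p \<in> U}"

text \<open>Bounded above by \<open>bdd_adm\<close>. For empty \<open>adm c U\<close> the value
  carries no meaning, so the limit statements assume nonemptiness.\<close>

definition rate :: "('e \<Rightarrow> 'b::real_normed_vector) \<Rightarrow> 'b set \<Rightarrow> real" where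
  "rate c U = (SUP (p, T)\<in>adm c U. ln (real (W (mset p))) / T)"

definition cnt :: "('e \<Rightarrow> 'b::real_normed_vector) \<Rightarrow> 'b set \<Rightarrow> real \<Rightarrow> nat" where
  "cnt c U T = card {p \<in> P. wt l p < T \<and> (1 / T) *\<^sub>R wt c p \<in> U}"

lemma bdd_adm: "bdd_above ((\<lambda>(p, T). ln (real (W (mset p))) / T) ` adm c U)"
proof -
  obtain s where s: "0 < s" "\<And>p. p \<in> P \<Longrightarrow> real (W (mset p)) \<le> exp (s * wt l p)"
    using W_exp_bound by blast
  show ?thesis
  proof (rule bdd_aboveI[of _ s], safe)
    fix p T assume "(p, T) \<in> adm c U"
    then have p: "p \<in> P" "wt l p < T" by (auto simp: adm_def)
    have "real (W (mset p)) \<le> exp (s * T)"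
      using s(2)[OF p(1)] p s(1) by (meson exp_le_cancel_iff less_imp_le mult_left_mono order_trans)
    then have "ln (real (W (mset p))) \<le> s * T"
      using W_pos[OF p(1)] by (subst ln_le_iff_le_exp) auto
    then show "ln (real (W (mset p))) / T \<le> s"
      using P_pos[OF p(1)] p by (simp add: field_simps)
  qed
qed

lemma ln_W_le_rate:
  assumes "(p, T) \<in> adm c U"
  shows "ln (real (W (mset p))) / T \<le> rate c U"
  unfolding rate_def using cSUP_upper[OF assms bdd_adm] by auto

definition h :: real where "h = rate (\<lambda>_. 0::real) UNIV"

lemma rate_UNIV: "rate c UNIV = h"
  by (simp add: h_def rate_def adm_def)

lemma h_nonneg: "0 \<le> h"
proof -
  obtain p where p: "p \<in> P" using nonempty by blast
  have "0 \<le> ln (real (W (mset p))) / (wt l p + 1)"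
    using W_pos[OF p] P_pos[OF p] by auto
  also have "\<dots> \<le> h" unfolding h_def by (rule ln_W_le_rate) (use p in \<open>auto simp: adm_def\<close>)
  finally show ?thesis .
qed

text \<open>Admissible thresholds lie strictly above \<open>wt l p\<close>, so the bound holds first
  for every such \<open>T\<close>, and then in the limit as \<open>T\<close> decreases to
  \<open>wt l p\<close>.\<close>

lemma W_le_exp_h:
  assumes p: "p \<in> P"
  shows "real (W (mset p)) \<le> exp (h * wt l p)"
proof -
  have *: "ln (real (W (mset p))) \<le> h * T" if "wt l p < T" for T
    using ln_W_le_rate[of p T "\<lambda>_. 0::real" UNIV] that p P_pos[OF p]
    by (auto simp: adm_def h_def field_simps)
  have "ln (real (W (mset p))) \<le> h * wt l p"
  proof (rule field_le_epsilon)
    fix e :: real assume e: "0 < e"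
    have "ln (real (W (mset p))) \<le> h * (wt l p + e / (h + 1))"
      using e h_nonneg by (intro *) auto
    also have "\<dots> \<le> h * wt l p + e"
      using e h_nonneg by (auto simp: field_simps)
    finally show "ln (real (W (mset p))) \<le> h * wt l p + e" .
  qed
  then show ?thesis using W_pos[OF p] by (subst (asm) ln_le_iff_le_exp) auto
qed

text \<open>Quantitative form of subexponentially many edge counts: \<open>s\<close> may be
  arbitrarily small, so fewer than \<open>exp (s * T)\<close> times a constant occur below length
  \<open>T\<close>.\<close>

lemma sum_le_types:
  assumes s: "0 < s"
  obtains M where "0 < M" "sum_le (\<lambda>m. exp (- s * (\<Sum>e\<in>#m. l e))) (mset ` P) M"
proof -
  obtain k where k: "0 < k" "\<And>e. e \<in> arcs G \<Longrightarrow> k \<le> l e" using min_length by blast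
  have *: "(\<Sum>e\<in>#m. - s * l e) = - s * (\<Sum>e\<in>#m. l e)" for m
    by (simp add: sum_mset_distrib_left)
  have "sum_le (\<lambda>m. exp (\<Sum>e\<in>#m. - s * l e)) {m. set_mset m \<subseteq> arcs G}
      (exp (E s / (1 - exp (- (s * k)))))"
    by (rule sum_le_multisets[OF E[OF s]]) (use s k in auto)
  then have "sum_le (\<lambda>m. exp (- s * (\<Sum>e\<in>#m. l e))) (mset ` P) (exp (E s / (1 - exp (- (s * k)))))"
    unfolding * by (rule sum_le_subset) (auto dest: subsetD[OF P_arcs])
  then show thesis using that by (meson exp_gt_zero)
qed

end

text \<open>The floor is the number of copies of a path with threshold \<open>a\<close> that fit
  below \<open>T\<close>.\<close>

lemma tendsto_nat_floor_divide:
  assumes "0 < a"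
  shows "((\<lambda>T :: real. real (nat \<lfloor>T / a\<rfloor>) / T) \<longlongrightarrow> 1 / a) at_top"
proof (rule tendsto_sandwich[of "\<lambda>T. 1 / a - 1 / T" _ _ "\<lambda>_. 1 / a"])
  show "\<forall>\<^sub>F T in at_top. 1 / a - 1 / T \<le> real (nat \<lfloor>T / a\<rfloor>) / T"
    using eventually_gt_at_top[of 0]
  proof eventually_elim
    case (elim T)
    have "T / a - 1 \<le> real (nat \<lfloor>T / a\<rfloor>)" using elim assms by linarith
    then have "(T / a - 1) / T \<le> real (nat \<lfloor>T / a\<rfloor>) / T" using elim by (intro divide_right_mono) auto
    then show ?case using elim assms by (simp add: diff_divide_distrib)
  qed
  show "\<forall>\<^sub>F T in at_top. real (nat \<lfloor>T / a\<rfloor>) / T \<le> 1 / a"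
    using eventually_gt_at_top[of 0]
  proof eventually_elim
    case (elim T)
    have "real (nat \<lfloor>T / a\<rfloor>) \<le> T / a" using elim assms by simp
    then have "real (nat \<lfloor>T / a\<rfloor>) / T \<le> (T / a) / T" using elim by (intro divide_right_mono) auto
    then show ?case using elim assms by simp
  qed
  have "((\<lambda>T :: real. 1 / a - inverse T) \<longlongrightarrow> 1 / a - 0) at_top"
    by (intro tendsto_intros tendsto_inverse_0_at_top filterlim_ident)
  then show "((\<lambda>T :: real. 1 / a - 1 / T) \<longlongrightarrow> 1 / a) at_top" by (simp add: divide_inverse)
qed simp

lemma wt_concat_replicate:
  fixes f :: "'e \<Rightarrow> 'b::real_vector"
  shows "wt f (concat (replicate k p)) = real k *\<^sub>R wt f p"
  by (induction k) (auto simp: algebra_simps)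

lemma mset_concat_replicate: "mset (concat (replicate k p)) = repeat_mset k (mset p)"
  by (induction k) auto

context length_graph
begin

text \<open>Grouping by edge counts: \<open>W_le_exp_h\<close> allows at most
  \<open>exp (h * wt l q)\<close> paths in the group of \<open>q\<close>, and the remaining factor
  with exponent \<open>s - h\<close> is summable over edge counts.\<close>

lemma sum_le_P:
  assumes "h < s"
  obtains M where "0 < M" "sum_le (\<lambda>p. exp (- s * wt l p)) P M"
proof -
  obtain M where M: "0 < M" "sum_le (\<lambda>m. exp (- (s - h) * (\<Sum>e\<in>#m. l e))) (mset ` P) M"
    using sum_le_types[of "s - h"] assms by auto
  have "sum_le (\<lambda>p. exp (- s * wt l p)) P M"
  proof (rule sum_leI)
    fix F assume F: "finite F" "F \<subseteq> P"
    have "(\<Sum>p\<in>F. exp (- s * wt l p)) = (\<Sum>m\<in>mset ` F. \<Sum>p\<in>{p \<in> F. mset p = m}. exp (- s * wt l p))"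
      using F by (simp add: sum.image_gen)
    also have "\<dots> \<le> (\<Sum>m\<in>mset ` F. exp (- (s - h) * (\<Sum>e\<in>#m. l e)))"
    proof (rule sum_mono)
      fix m assume "m \<in> mset ` F"
      then obtain q where q: "q \<in> P" "m = mset q" using F by auto
      have "(\<Sum>p\<in>{p \<in> F. mset p = m}. exp (- s * wt l p)) = (\<Sum>p\<in>{p \<in> F. mset p = m}. exp (- s * wt l q))"
        by (rule sum.cong) (auto simp: q wt_mset)
      also have "\<dots> = real (card {p \<in> F. mset p = m}) * exp (- s * wt l q)" by simp
      also have "\<dots> \<le> real (W m) * exp (- s * wt l q)"
        unfolding W_def using F finite_W by (intro mult_right_mono of_nat_mono card_mono) auto
      also have "\<dots> \<le> exp (h * wt l q) * exp (- s * wt l q)"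
        using W_le_exp_h[OF q(1)] q by (intro mult_right_mono) auto
      also have "\<dots> = exp (- (s - h) * (\<Sum>e\<in>#m. l e))"
        by (simp add: mult_exp_exp q wt_mset[symmetric] algebra_simps)
      finally show "(\<Sum>p\<in>{p \<in> F. mset p = m}. exp (- s * wt l p)) \<le> exp (- (s - h) * (\<Sum>e\<in>#m. l e))" .
    qed
    also have "\<dots> \<le> M" using F by (intro sum_leD[OF M(2)]) auto
    finally show "(\<Sum>p\<in>F. exp (- s * wt l p)) \<le> M" .
  qed
  then show thesis using that M by blast
qed

lemma finite_below: "finite {p \<in> P. wt l p < T}"
proof -
  obtain M where M: "0 < M" "sum_le (\<lambda>p. exp (- (h + 1) * wt l p)) P M"
    using sum_le_P[of "h + 1"] by auto
  show ?thesis
  proof (rule sum_le_card(1)[OF sum_le_subset[OF M(2)]])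
    show "exp (- (h + 1) * T) \<le> exp (- (h + 1) * wt l p)" if "p \<in> {p \<in> P. wt l p < T}" for p
      using that h_nonneg by (simp add: mult_left_mono)
  qed auto
qed

lemma cnt_eq_0: "adm c U = {} \<Longrightarrow> cnt c U T = 0"
  by (auto simp: adm_def cnt_def card_eq_0_iff)

text \<open>At most \<open>M * exp (s * T)\<close> edge counts occur below \<open>T\<close>, each
  shared by at most \<open>exp (rate c U * T)\<close> paths.\<close>

lemma cnt_upper:
  assumes "0 < s"
  obtains M where "0 < M" "\<And>T. real (cnt c U T) \<le> M * exp ((s + rate c U) * T)"
proof -
  obtain M where M: "0 < M" "sum_le (\<lambda>m. exp (- s * (\<Sum>e\<in>#m. l e))) (mset ` P) M"
    using sum_le_types[OF assms] by auto
  have "real (cnt c U T) \<le> M * exp ((s + rate c U) * T)" for T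
  proof -
    let ?A = "{p \<in> P. wt l p < T \<and> (1 / T) *\<^sub>R wt c p \<in> U}"
    have fin: "finite ?A" by (rule finite_subset[OF _ finite_below[of T]]) auto
    have types: "real (card (mset ` ?A)) * exp (- s * T) \<le> M"
      by (rule sum_le_card(2)[OF sum_le_subset[OF M(2)]])
        (use assms in \<open>auto simp: wt_mset[symmetric]\<close>)
    have "card ?A = (\<Sum>m\<in>mset ` ?A. card {p \<in> ?A. mset p = m})"
      using sum.image_gen[OF fin, of "\<lambda>_. 1::nat" mset] by simp
    then have "real (cnt c U T) = (\<Sum>m\<in>mset ` ?A. real (card {p \<in> ?A. mset p = m}))"
      by (simp add: cnt_def)
    also have "\<dots> \<le> (\<Sum>m\<in>mset ` ?A. exp (rate c U * T))"
    proof (rule sum_mono)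
      fix m assume "m \<in> mset ` ?A"
      then obtain q where q: "q \<in> ?A" "m = mset q" by auto
      have T: "0 < T" using q P_pos[of q] by auto
      have "ln (real (W m)) / T \<le> rate c U"
        using q by (auto intro!: ln_W_le_rate simp: adm_def)
      then have "ln (real (W m)) \<le> rate c U * T" using T by (simp add: field_simps)
      then have "real (W m) \<le> exp (rate c U * T)"
        using W_pos[of q] q by (subst (asm) ln_le_iff_le_exp) auto
      moreover have "card {p \<in> ?A. mset p = m} \<le> W m"
        unfolding W_def by (rule card_mono[OF finite_W]) auto
      ultimately show "real (card {p \<in> ?A. mset p = m}) \<le> exp (rate c U * T)" by linarith
    qed
    also have "\<dots> = (real (card (mset ` ?A)) * exp (- s * T)) * exp ((s + rate c U) * T)"
      by (simp add: mult.assoc mult_exp_exp algebra_simps)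
    also have "\<dots> \<le> M * exp ((s + rate c U) * T)"
      using types by (rule mult_right_mono) simp
    finally show ?thesis .
  qed
  then show thesis using that M by blast
qed

text \<open>Length and cost depend only on edge counts, so every closed path with the edge counts of
  \<open>nat \<lfloor>T / T0\<rfloor>\<close> copies of \<open>p\<close> is counted;
  \<open>W_power\<close> gives many of them.\<close>

lemma cnt_lower:
  assumes p: "p \<in> P" "wt l p < T0" and T: "T0 \<le> T"
    and U: "(real (nat \<lfloor>T / T0\<rfloor>) / T) *\<^sub>R wt c p \<in> U"
  shows "W (mset p) ^ nat \<lfloor>T / T0\<rfloor> \<le> cnt c U T"
proof -
  let ?k = "nat \<lfloor>T / T0\<rfloor>"
  have T0: "0 < T0" using P_pos[OF p(1)] p by linarith
  have k: "1 \<le> ?k" using T T0 by (simp add: le_nat_iff le_floor_iff)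
  have kT: "real ?k * T0 \<le> T"
  proof -
    have "real ?k \<le> T / T0" using T T0 by simp
    then show ?thesis using T0 by (simp add: field_simps)
  qed
  have "W (mset p) ^ ?k \<le> W (repeat_mset ?k (mset p))" by (rule W_power[OF k])
  also have "\<dots> \<le> cnt c U T"
    unfolding W_def cnt_def
  proof (rule card_mono, rule finite_subset[OF _ finite_below[of T]], force, safe)
    fix q assume q: "q \<in> P" "mset q = repeat_mset ?k (mset p)"
    have *: "mset q = mset (concat (replicate ?k p))" using q by (simp add: mset_concat_replicate)
    have "wt l q = real ?k * wt l p"
      using wt_concat_replicate[of l ?k p] * by (simp add: wt_mset del: mset_concat)
    also have "\<dots> < real ?k * T0" using k p by (intro mult_strict_left_mono) linarith+
    also note kT
    finally show "wt l q < T" .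
    have "wt c q = real ?k *\<^sub>R wt c p"
      using wt_concat_replicate[of c ?k p] * by (simp add: wt_mset del: mset_concat)
    then show "(1 / T) *\<^sub>R wt c q \<in> U" using U by simp
  qed
  finally show ?thesis .
qed

text \<open>Openness of \<open>U\<close> enters here: the scaled cost of the repeated path converges
  to a point of \<open>U\<close>, hence lies in \<open>U\<close> for all large
  \<open>T\<close>.\<close>

lemma cnt_pos:
  assumes U: "open U" and adm: "adm c U \<noteq> {}"
  shows "\<forall>\<^sub>F T in at_top. 0 < cnt c U T"
    and "a < rate c U \<Longrightarrow> \<forall>\<^sub>F T in at_top. a < ln (real (cnt c U T)) / T"
proof -
  have *: "\<forall>\<^sub>F T in at_top. T0 \<le> T \<and> 0 < T \<and> W (mset p) ^ nat \<lfloor>T / T0\<rfloor> \<le> cnt c U T"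
    if "(p, T0) \<in> adm c U" for p T0
  proof -
    have p: "p \<in> P" "wt l p < T0" "(1 / T0) *\<^sub>R wt c p \<in> U" using that by (auto simp: adm_def)
    have T0: "0 < T0" using P_pos[OF p(1)] p by linarith
    have "((\<lambda>T. (real (nat \<lfloor>T / T0\<rfloor>) / T) *\<^sub>R wt c p) \<longlongrightarrow> (1 / T0) *\<^sub>R wt c p) at_top"
      by (intro tendsto_intros tendsto_nat_floor_divide T0)
    then have "\<forall>\<^sub>F T in at_top. (real (nat \<lfloor>T / T0\<rfloor>) / T) *\<^sub>R wt c p \<in> U"
      using U p(3) by (rule topological_tendstoD)
    with eventually_ge_at_top[of T0] show ?thesis
    proof eventually_elim
      case (elim T) then show ?case using cnt_lower[OF p(1,2)] T0 by auto
    qed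
  qed
  obtain p T0 where p: "(p, T0) \<in> adm c U" using adm by auto
  show "\<forall>\<^sub>F T in at_top. 0 < cnt c U T"
    using *[OF p]
  proof eventually_elim
    case (elim T)
    have "0 < W (mset p) ^ nat \<lfloor>T / T0\<rfloor>" using W_pos[of p] p by (auto simp: adm_def)
    then show ?case using elim by linarith
  qed
  assume "a < rate c U"
  \<comment> \<open>A nearly optimal pair for the supremum; its repetitions realise almost the full
    rate.\<close>
  then obtain p T0 where pT: "(p, T0) \<in> adm c U" "a < ln (real (W (mset p))) / T0"
    unfolding rate_def using less_cSUP_iff[OF adm bdd_adm] by auto
  then have p: "p \<in> P" "wt l p < T0" by (auto simp: adm_def)
  have T0: "0 < T0" using P_pos[OF p(1)] p by linarith
  have "((\<lambda>T. real (nat \<lfloor>T / T0\<rfloor>) / T * ln (real (W (mset p)))) \<longlongrightarrow> 1 / T0 * ln (real (W (mset p)))) at_top"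
    by (intro tendsto_intros tendsto_nat_floor_divide T0)
  then have "\<forall>\<^sub>F T in at_top. a < real (nat \<lfloor>T / T0\<rfloor>) / T * ln (real (W (mset p)))"
    using pT(2) by (intro order_tendstoD(1)) auto
  with *[OF pT(1)] show "\<forall>\<^sub>F T in at_top. a < ln (real (cnt c U T)) / T"
  proof eventually_elim
    case (elim T)
    let ?k = "nat \<lfloor>T / T0\<rfloor>"
    have W: "1 \<le> W (mset p)" by (rule W_pos[OF p(1)])
    have "real ?k * ln (real (W (mset p))) = ln (real (W (mset p) ^ ?k))"
      using W by (simp add: ln_realpow)
    also have "\<dots> \<le> ln (real (cnt c U T))"
      using elim W by (intro ln_mono) (auto simp flip: of_nat_power)
    finally have "real ?k * ln (real (W (mset p))) / T \<le> ln (real (cnt c U T)) / T"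
      using elim by (intro divide_right_mono) auto
    then show ?case using elim by simp
  qed
qed

text \<open>The lower bound by repetition and the upper bound \<open>cnt_upper\<close> with
  arbitrarily small \<open>s\<close> meet at the supremum, so the limit exists.\<close>

lemma cnt_limit:
  assumes U: "open U" and adm: "adm c U \<noteq> {}"
  shows "((\<lambda>T. ln (real (cnt c U T)) / T) \<longlongrightarrow> rate c U) at_top"
proof (rule order_tendstoI)
  show "\<forall>\<^sub>F T in at_top. a < ln (real (cnt c U T)) / T" if "a < rate c U" for a
    using cnt_pos(2)[OF assms that] .
  fix a assume a: "rate c U < a"
  define s where "s = (a - rate c U) / 2"
  have s: "0 < s" "rate c U + s < a" using a by (auto simp: s_def field_simps)
  obtain M where M: "0 < M" "\<And>T. real (cnt c U T) \<le> M * exp ((s + rate c U) * T)"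
    using cnt_upper[OF s(1), of c U] by blast
  have "((\<lambda>T :: real. ln M * inverse T + (s + rate c U)) \<longlongrightarrow> ln M * 0 + (s + rate c U)) at_top"
    by (intro tendsto_intros tendsto_inverse_0_at_top filterlim_ident)
  then have "\<forall>\<^sub>F T in at_top. ln M * inverse T + (s + rate c U) < a"
    by (rule order_tendstoD(2)) (use s in simp)
  with cnt_pos(1)[OF assms] eventually_gt_at_top[of 0]
  show "\<forall>\<^sub>F T in at_top. ln (real (cnt c U T)) / T < a"
  proof eventually_elim
    case (elim T)
    have "ln (real (cnt c U T)) \<le> ln (M * exp ((s + rate c U) * T))"
      using elim M(2)[of T] by (intro ln_mono) auto
    also have "\<dots> = ln M + (s + rate c U) * T" using M(1) by (simp add: ln_mult)
    finally have "ln (real (cnt c U T)) / T \<le> (ln M + (s + rate c U) * T) / T"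
      using elim by (intro divide_right_mono) auto
    also have "\<dots> = ln M * inverse T + (s + rate c U)" using elim by (simp add: field_simps)
    also have "\<dots> < a" using elim by simp
    finally show ?case .
  qed
qed

lemma rate_le:
  assumes U: "open U" "adm c U \<noteq> {}" and "0 < C"
    and bound: "\<And>T. 0 < T \<Longrightarrow> real (cnt c U T) \<le> C * exp (a * T)"
  shows "rate c U \<le> a"
proof (rule tendsto_upperbound[OF _ _ trivial_limit_at_top_linorder])
  show "((\<lambda>T. ln (real (cnt c U T)) / T - ln C * inverse T) \<longlongrightarrow> rate c U) at_top"
    using tendsto_diff[OF cnt_limit[OF U]
        tendsto_mult[OF tendsto_const[of "ln C"] tendsto_inverse_0_at_top[OF filterlim_ident]]] by simp
  show "\<forall>\<^sub>F T in at_top. ln (real (cnt c U T)) / T - ln C * inverse T \<le> a"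
    using cnt_pos(1)[OF U] eventually_gt_at_top[of 0]
  proof eventually_elim
    case (elim T)
    have "ln (real (cnt c U T)) \<le> ln (C * exp (a * T))"
      using elim bound[of T] by (intro ln_mono) auto
    also have "\<dots> = ln C + a * T" using assms(3) by (simp add: ln_mult)
    finally have "ln (real (cnt c U T)) / T \<le> (ln C + a * T) / T"
      using elim by (intro divide_right_mono) auto
    then show ?case using elim by (simp add: field_simps)
  qed
qed

end

section \<open>First return paths\<close>

context length_graph
begin

lemma awalk_arcs: "awalk u p w \<Longrightarrow> set p \<subseteq> arcs G"
  by (simp add: awalk_def)

lemma awalk_hd: "awalk u p w \<Longrightarrow> p \<noteq> [] \<Longrightarrow> tail G (hd p) = u"
  by (cases p) (auto simp: awalk_Cons_iff)

lemma awalk_last: "awalk u p w \<Longrightarrow> p \<noteq> [] \<Longrightarrow> head G (last p) = w"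
  by (induction p rule: rev_induct) (auto simp: awalk_simps)

lemma G2_walks:
  obtains C where "0 < C"
    "\<And>e e'. e \<in> arcs G \<Longrightarrow> e' \<in> arcs G \<Longrightarrow>
      \<exists>p. awalk (tail G e) p (head G e') \<and> p \<noteq> [] \<and> hd p = e \<and> last p = e' \<and> wt l p < C + l e + l e'"
proof -
  obtain C where C: "0 < C" "\<forall>e\<in>arcs G. \<forall>e'\<in>arcs G.
     \<exists>u p w. awalk u p w \<and> p \<noteq> [] \<and> hd p = e \<and> last p = e' \<and> wt l p < C + l e + l e'"
    using G2[unfolded G2_def awalk_cost_wt] by (elim exE conjE) (rule that)
  show thesis
  proof (rule that[OF C(1)])
    fix e e' assume "e \<in> arcs G" "e' \<in> arcs G"
    then obtain u p w where p: "awalk u p w" "p \<noteq> []" "hd p = e" "last p = e'" "wt l p < C + l e + l e'"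
      using C(2) by blast
    have "u = tail G e" "w = head G e'" using awalk_hd[OF p(1,2)] awalk_last[OF p(1,2)] p by auto
    then show "\<exists>p. awalk (tail G e) p (head G e') \<and> p \<noteq> [] \<and> hd p = e \<and> last p = e' \<and> wt l p < C + l e + l e'"
      using p by blast
  qed
qed

lemma arc_out_of_v: obtains d where "d \<in> arcs G" "tail G d = v"
proof -
  obtain p where p: "p \<in> P" using nonempty by blast
  show thesis
  proof (rule that[of "hd p"])
    show "hd p \<in> arcs G" using P_arcs[OF p] p by (auto simp: P_iff)
    show "tail G (hd p) = v" using p by (auto simp: P_iff intro: awalk_hd)
  qed
qed

lemma arc_into_v: obtains d where "d \<in> arcs G" "head G d = v"
proof -
  obtain p where p: "p \<in> P" using nonempty by blast
  show thesis
  proof (rule that[of "last p"])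
    show "last p \<in> arcs G" using P_arcs[OF p] p by (auto simp: P_iff)
    show "head G (last p) = v" using p by (auto simp: P_iff intro: awalk_last)
  qed
qed

text \<open>Take the path from \<open>G2\<close> that starts with an edge \<open>d\<close> leaving
  \<open>v\<close> and ends with \<open>e\<close>, and keep only what follows its last departure
  from \<open>v\<close>. Omitting \<open>l e\<close> itself leaves a bound independent of
  \<open>e\<close>.\<close>

lemma walks_from_v:
  obtains K where "0 < K" "\<And>e. e \<in> arcs G \<Longrightarrow>
    \<exists>a. awalk v (a @ [e]) (head G e) \<and> v \<notin> tail G ` set (tl (a @ [e])) \<and> wt l a \<le> K"
proof -
  obtain C where C: "0 < C"
    "\<And>e e'. e \<in> arcs G \<Longrightarrow> e' \<in> arcs G \<Longrightarrow>
      \<exists>p. awalk (tail G e) p (head G e') \<and> p \<noteq> [] \<and> hd p = e \<and> last p = e' \<and> wt l p < C + l e + l e'"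
    using G2_walks by blast
  obtain d where d: "d \<in> arcs G" "tail G d = v" using arc_out_of_v by blast
  show thesis
  proof (rule that[of "C + l d"])
    show "0 < C + l d" using C d l_pos by (simp add: add_pos_pos)
    fix e assume e: "e \<in> arcs G"
    obtain p where p: "awalk v p (head G e)" "p \<noteq> []" "hd p = d" "last p = e" "wt l p < C + l d + l e"
      using C(2)[OF d(1) e] d by auto
    have "\<exists>x\<in>set p. tail G x = v" using p d by (metis hd_in_set)
    then obtain xs f ys where split: "p = xs @ f # ys" "tail G f = v" "\<forall>y\<in>set ys. tail G y \<noteq> v"
      using split_list_last_prop[of p "\<lambda>x. tail G x = v"] by blast
    define a where "a = butlast (f # ys)"
    have a: "f # ys = a @ [e]"
      using p(4) split(1) append_butlast_last_id[of "f # ys"] by (simp add: a_def)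
    have w: "awalk v (f # ys) (head G e)"
      using p(1) split(2) unfolding split(1) by (auto simp: awalk_Cons_iff)
    have "set xs \<subseteq> arcs G" using p(1) unfolding split(1) by auto
    then have "0 \<le> wt l xs" by (rule wt_l_nonneg)
    moreover have "wt l p = wt l xs + wt l a + l e" unfolding split(1) a by simp
    ultimately have "wt l a \<le> C + l d" using p(5) by simp
    moreover have "v \<notin> tail G ` set (tl (a @ [e]))" using split(3) by (auto simp: a[symmetric])
    ultimately show "\<exists>a. awalk v (a @ [e]) (head G e) \<and> v \<notin> tail G ` set (tl (a @ [e])) \<and> wt l a \<le> C + l d"
      using w unfolding a by blast
  qed
qed

text \<open>Take the path from \<open>G2\<close> that starts with \<open>e\<close> and ends with an
  edge into \<open>v\<close>, drop \<open>e\<close>, and stop at the first later edge leaving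
  \<open>v\<close>. The list \<open>b\<close> may be empty.\<close>

lemma walks_to_v:
  obtains K where "0 < K" "\<And>e. e \<in> arcs G \<Longrightarrow>
    \<exists>b. awalk (head G e) b v \<and> v \<notin> tail G ` set b \<and> wt l b \<le> K"
proof -
  obtain C where C: "0 < C"
    "\<And>e e'. e \<in> arcs G \<Longrightarrow> e' \<in> arcs G \<Longrightarrow>
      \<exists>p. awalk (tail G e) p (head G e') \<and> p \<noteq> [] \<and> hd p = e \<and> last p = e' \<and> wt l p < C + l e + l e'"
    using G2_walks by blast
  obtain d where d: "d \<in> arcs G" "head G d = v" using arc_into_v by blast
  show thesis
  proof (rule that[of "C + l d"])
    show "0 < C + l d" using C d l_pos by (simp add: add_pos_pos)
    fix e assume e: "e \<in> arcs G"
    obtain p where p: "awalk (tail G e) p v" "p \<noteq> []" "hd p = e" "wt l p < C + l e + l d"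
      using C(2)[OF e d(1)] d by auto
    then obtain q where q: "p = e # q" by (cases p) auto
    have w: "awalk (head G e) q v" using p(1) by (simp add: q awalk_Cons_iff)
    have wq: "wt l q \<le> C + l d" using p(4) by (simp add: q)
    show "\<exists>b. awalk (head G e) b v \<and> v \<notin> tail G ` set b \<and> wt l b \<le> C + l d"
    proof (cases "v \<in> tail G ` set q")
      case True
      then obtain xs f ys where split: "q = xs @ f # ys" "tail G f = v" "\<forall>y\<in>set xs. tail G y \<noteq> v"
        using split_list_first_prop[of q "\<lambda>x. tail G x = v"] by blast
      have "awalk (head G e) xs v"
        using w split(2) unfolding split(1) by (auto simp: awalk_Cons_iff)
      moreover have "set (f # ys) \<subseteq> arcs G" using awalk_arcs[OF w] unfolding split(1) by auto
      then have "0 \<le> wt l (f # ys)" by (rule wt_l_nonneg)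
      then have "wt l xs \<le> C + l d" using wq by (simp add: split(1))
      ultimately show ?thesis using split(3) by blast
    next
      case False
      then show ?thesis using w wq by blast
    qed
  qed
qed

text \<open>
  If \<open>h\<close> were 0, then \<open>p @ q\<close> and \<open>q @ p\<close>, having equal edge counts, would coincide for all closed
  paths \<open>p\<close>, \<open>q\<close> at \<open>v\<close>; lengths would then be a fixed multiple of the number of edges,
  contrary to \<open>G3\<close>.
\<close>

lemma h_pos: "0 < h"
proof (rule ccontr)
  assume "\<not> 0 < h"
  then have h0: "h = 0" using h_nonneg by simp
  have W1: "W (mset p) \<le> 1" if "p \<in> P" for p using W_le_exp_h[OF that] h0 by simp
  have ratio: "wt l p * length q = wt l q * length p" if p: "p \<in> P" and q: "q \<in> P" for p q
  proof -
    have "p @ q = q @ p"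
      using W1[OF P_append[OF p q]] P_append[OF p q] P_append[OF q p] finite_W
      unfolding W_def by (auto simp: card_le_Suc0_iff_eq)
    \<comment> \<open>Commuting words are powers of a common word.\<close>
    then obtain m n zs where z: "concat (replicate m zs) = p" "concat (replicate n zs) = q"
      using comm_append_are_replicate by blast
    have "wt l p = real m * wt l zs" "wt l q = real n * wt l zs"
      using wt_concat_replicate[of l] z by force+
    moreover have "length p = m * length zs" "length q = n * length zs"
      using z by (auto simp: length_concat sum_list_replicate)
    ultimately show ?thesis by simp
  qed
  obtain p0 where p0: "p0 \<in> P" using nonempty by blast
  define d where "d = wt l p0 / length p0"
  have "p0 \<noteq> []" using p0 by (simp add: P_iff)
  then have d: "0 < d" using P_pos[OF p0] by (simp add: d_def)
  have len: "wt l q = d * length q" if "q \<in> P" for q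
    using ratio[OF p0 that] \<open>p0 \<noteq> []\<close> by (simp add: d_def field_simps)
  have "wt l r = d * length r" if r: "closed_w r" for r
  proof -
    obtain w where w: "awalk w r w" "r \<noteq> []" using r by (auto simp: closed_w_def)
    have arcs: "hd r \<in> arcs G" "last r \<in> arcs G"
      using awalk_arcs[OF w(1)] hd_in_set[OF w(2)] last_in_set[OF w(2)] by auto
    obtain a where "awalk v (a @ [hd r]) (head G (hd r))" using walks_from_v arcs(1) by metis
    then have a: "awalk v a w" using awalk_hd[OF w] by (auto simp: awalk_simps)
    obtain b where "awalk (head G (last r)) b v" using walks_to_v arcs(2) by metis
    then have b: "awalk w b v" using awalk_last[OF w] by simp
    have p: "awalk v p0 v" "p0 \<noteq> []" using p0 by (auto simp: P_iff)
    \<comment> \<open>Inserting \<open>r\<close> into a closed path at \<open>v\<close> expresses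
      its length as a difference of two known lengths. The prefix \<open>p0\<close> keeps the first
      path nonempty even when \<open>a\<close> and \<open>b\<close> are empty.\<close>
    have "p0 @ a @ b \<in> P" "p0 @ a @ r @ b \<in> P"
      using p a b w awalk_appendI unfolding P_iff by blast+
    from this[THEN len] show ?thesis by (simp add: algebra_simps)
  qed
  then have "{awalk_cost l p | p. closed_w p} \<subseteq> {d * real k | k. True}"
    by (auto simp: awalk_cost_wt)
  then show False using G3 d unfolding G3_def by blast
qed

definition R :: "'e list set" where
  "R = {p. awalk v p v \<and> p \<noteq> [] \<and> v \<notin> tail G ` set (tl p)}"

text \<open>
  Paths without interior visits to \<open>v\<close>: the interior vertices are the tails of all edges but the
  first.
\<close>

definition Q :: "'e list set" where
  "Q = {p. p \<noteq> [] \<and> (\<exists>u w. awalk u p w) \<and> v \<notin> tail G ` set (tl p)}"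

lemma R_subset_P: "R \<subseteq> P"
  by (auto simp: R_def P_iff)

lemma R_subset_Q: "R \<subseteq> Q"
  by (auto simp: R_def Q_def)

lemma Q_arcs: "p \<in> Q \<Longrightarrow> set p \<subseteq> arcs G"
  by (auto simp: Q_def)

text \<open>Cut at the first return to \<open>v\<close> and recurse on the shorter
  remainder.\<close>

lemma P_decomp:
  assumes "p \<in> P"
  shows "\<exists>ps. p = concat ps \<and> set ps \<subseteq> R"
  using assms
proof (induction p rule: length_induct)
  case (1 p)
  then have p: "awalk v p v" "p \<noteq> []" by (auto simp: P_iff)
  then obtain e q where q: "p = e # q" by (cases p) auto
  show ?case
  proof (cases "v \<in> tail G ` set q")
    case False
    then have "p \<in> R" using p by (auto simp: R_def q)
    then have "p = concat [p] \<and> set [p] \<subseteq> R" by simp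
    then show ?thesis by blast
  next
    case True
    then obtain xs f ys where split: "q = xs @ f # ys" "tail G f = v" "\<forall>y\<in>set xs. tail G y \<noteq> v"
      using split_list_first_prop[of q "\<lambda>x. tail G x = v"] by blast
    have "p = (e # xs) @ (f # ys)" by (simp add: q split(1))
    then have w: "awalk v (e # xs) v" "awalk v (f # ys) v"
      using p(1) split(2) by (auto simp: awalk_Cons_iff)
    then have "e # xs \<in> R" using split(3) by (auto simp: R_def)
    moreover obtain ps where "f # ys = concat ps" "set ps \<subseteq> R"
      using 1(1)[rule_format, of "f # ys"] w(2) by (auto simp: q split(1) P_iff)
    ultimately have "p = concat ((e # xs) # ps) \<and> set ((e # xs) # ps) \<subseteq> R"
      by (simp add: q split(1))
    then show ?thesis by blast
  qed
qed

text \<open>\<open>R\<close> is a prefix code: an edge following \<open>r\<close> would start at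
  \<open>v\<close> in the interior of the longer path.\<close>

lemma R_prefix: "r \<in> R \<Longrightarrow> r @ us \<in> R \<Longrightarrow> us = []"
proof (rule ccontr)
  assume r: "r \<in> R" "r @ us \<in> R" and "us \<noteq> []"
  then obtain f ys where f: "us = f # ys" by (cases us) auto
  have "awalk v r v" using r by (simp add: R_def)
  then have "tail G f = v"
    using r(2) by (auto simp: R_def f awalk_Cons_iff)
  moreover have "f \<in> set (tl (r @ us))" using r by (auto simp: f R_def)
  ultimately show False using r(2) by (auto simp: R_def)
qed

lemma inj_on_concat_R: "inj_on concat {ps. set ps \<subseteq> R}"
proof (rule inj_onI)
  fix ps qs :: "'e list list"
  assume "ps \<in> {ps. set ps \<subseteq> R}" "qs \<in> {ps. set ps \<subseteq> R}" "concat ps = concat qs"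
  then show "ps = qs"
  proof (induction ps arbitrary: qs)
    case Nil
    then have "\<forall>q\<in>set qs. q = []" by simp
    with Nil show ?case by (cases qs) (auto simp: R_def)
  next
    case (Cons r ps)
    have "r \<noteq> []" using Cons.prems by (auto simp: R_def)
    then obtain r' qs' where qs: "qs = r' # qs'" using Cons.prems by (cases qs) auto
    have rr: "r \<in> R" "r' \<in> R" using Cons.prems qs by auto
    from Cons.prems(3) qs have "r @ concat ps = r' @ concat qs'" by simp
    then obtain us where "r = r' @ us \<and> us @ concat ps = concat qs' \<or> r @ us = r' \<and> concat ps = us @ concat qs'"
      by (auto simp: append_eq_append_conv2)
    then have "r = r' \<and> concat ps = concat qs'"
      using R_prefix[of r us] R_prefix[of r' us] rr by fastforce
    then show ?case using Cons qs by auto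
  qed
qed

text \<open>By unique decoding, the powers of a finite partial sum over \<open>R\<close> are sums
  over distinct closed paths, hence bounded by one constant \<open>M\<close>. A number above 1 would
  have unbounded powers.\<close>

lemma sum_R_gt_h:
  assumes "h < s"
  shows "sum_le (\<lambda>r. exp (- s * wt l r)) R 1"
proof (rule sum_leI)
  fix X assume X: "finite X" "X \<subseteq> R"
  let ?x = "\<Sum>r\<in>X. exp (- s * wt l r)"
  obtain M where M: "0 < M" "sum_le (\<lambda>p. exp (- s * wt l p)) P M" using sum_le_P[OF assms] by blast
  have power: "?x ^ Suc k \<le> M" for k
  proof -
    let ?L = "{ps. set ps \<subseteq> X \<and> length ps = Suc k}"
    have "?x ^ n = (\<Sum>ps\<in>{ps. set ps \<subseteq> X \<and> length ps = n}. exp (- s * wt l (concat ps)))" for n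
    proof (induction n)
      case 0
      have "{ps. set ps \<subseteq> X \<and> length ps = 0} = {[]}" by auto
      then show ?case by simp
    next
      case (Suc n)
      have "{ps. set ps \<subseteq> X \<and> length ps = Suc n} = (\<lambda>(r, ps). r # ps) ` (X \<times> {ps. set ps \<subseteq> X \<and> length ps = n})"
        by (auto simp: length_Suc_conv image_iff)
      moreover have "inj_on (\<lambda>(r, ps). r # ps) (X \<times> {ps. set ps \<subseteq> X \<and> length ps = n})"
        by (auto simp: inj_on_def)
      ultimately have "(\<Sum>ps\<in>{ps. set ps \<subseteq> X \<and> length ps = Suc n}. exp (- s * wt l (concat ps)))
          = (\<Sum>(r, ps)\<in>X \<times> {ps. set ps \<subseteq> X \<and> length ps = n}. exp (- s * wt l r) * exp (- s * wt l (concat ps)))"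
        by (simp add: sum.reindex case_prod_unfold mult_exp_exp algebra_simps)
      also have "\<dots> = ?x * ?x ^ n" unfolding Suc.IH by (simp add: sum_product sum.cartesian_product)
      finally show ?case by simp
    qed
    then have "?x ^ Suc k = (\<Sum>ps\<in>?L. exp (- s * wt l (concat ps)))" .
    also have "\<dots> = (\<Sum>p\<in>concat ` ?L. exp (- s * wt l p))"
      using X by (subst sum.reindex) (auto intro: inj_on_subset[OF inj_on_concat_R])
    also have "\<dots> \<le> M"
    proof (rule sum_leD[OF M(2)])
      show "finite (concat ` ?L)" using X(1) by (intro finite_imageI finite_lists_length_eq)
      show "concat ` ?L \<subseteq> P"
      proof safe
        fix ps assume ps: "set ps \<subseteq> X" "length ps = Suc k"
        have "set ps \<subseteq> P" using ps X R_subset_P by blast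
        moreover have "ps \<noteq> []" using ps by auto
        ultimately show "concat ps \<in> P" by (rule P_concat)
      qed
    qed
    finally show ?thesis .
  qed
  show "?x \<le> 1"
  proof (rule ccontr)
    assume x: "\<not> ?x \<le> 1"
    then obtain n where n: "M < ?x ^ n" using real_arch_pow[of ?x M] by auto
    also have "\<dots> \<le> ?x ^ Suc n" using x by (intro power_increasing) auto
    finally show False using power[of n] by simp
  qed
qed

text \<open>Each finite partial sum is continuous in the exponent, so the bound persists as
  \<open>s\<close> decreases to \<open>h\<close>.\<close>

lemma sum_R: "sum_le (\<lambda>r. exp (- h * wt l r)) R 1"
proof (rule sum_leI)
  fix X assume X: "finite X" "X \<subseteq> R"
  have "((\<lambda>s. \<Sum>r\<in>X. exp (- s * wt l r)) \<longlongrightarrow> (\<Sum>r\<in>X. exp (- h * wt l r))) (at_right h)"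
    by (intro tendsto_intros)
  moreover have "\<forall>\<^sub>F s in at_right h. (\<Sum>r\<in>X. exp (- s * wt l r)) \<le> 1"
    using eventually_at_right_less[of h]
    by eventually_elim (rule sum_leD[OF sum_R_gt_h X])
  ultimately show "(\<Sum>r\<in>X. exp (- h * wt l r)) \<le> 1"
    by (rule tendsto_upperbound) simp
qed

end

section \<open>The spectral gap\<close>

context length_graph
begin

lemma length_le_wt:
  assumes "\<And>e. e \<in> arcs G \<Longrightarrow> k \<le> l e" "set p \<subseteq> arcs G"
  shows "k * length p \<le> wt l p"
  using assms(2)
proof (induction p)
  case (Cons e p)
  then show ?case using assms(1)[of e] by (simp add: algebra_simps)
qed simp

text \<open>
  Every \<open>p \<in> Q\<close> extends, by boundedly many edges of bounded total length at either end, to a first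
  return path; \<open>p\<close> is recovered from the extension and the two numbers of added edges.
\<close>

lemma sum_Q_h: obtains B where "sum_le (\<lambda>p. exp (- h * wt l p)) Q B"
proof -
  obtain K1 a where K1: "0 < K1" and a: "\<And>e. e \<in> arcs G \<Longrightarrow>
      awalk v (a e @ [e]) (head G e) \<and> v \<notin> tail G ` set (tl (a e @ [e])) \<and> wt l (a e) \<le> K1"
    using walks_from_v by metis
  obtain K2 b where K2: "0 < K2" and b: "\<And>e. e \<in> arcs G \<Longrightarrow>
      awalk (head G e) (b e) v \<and> v \<notin> tail G ` set (b e) \<and> wt l (b e) \<le> K2"
    using walks_to_v by metis
  obtain k where k: "0 < k" "\<And>e. e \<in> arcs G \<Longrightarrow> k \<le> l e" using min_length by blast
  \<comment> \<open>Bounds the number of edges added at either end, since each has length at least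
    \<open>k\<close>.\<close>
  define N where "N = nat \<lceil>(K1 + K2) / k\<rceil>"
  have N: "length p \<le> N" if "set p \<subseteq> arcs G" "wt l p \<le> K1 + K2" for p
  proof -
    have "k * length p \<le> K1 + K2" using length_le_wt[OF k(2) that(1)] that(2) by simp
    then have "real (length p) \<le> (K1 + K2) / k" using k(1) by (simp add: field_simps)
    then show ?thesis unfolding N_def by linarith
  qed
  define ext where "ext p = a (hd p) @ p @ b (last p)" for p
  define F where "F p = (ext p, length (a (hd p)), length (b (last p)))" for p
  have main: "ext p \<in> R \<and> length (a (hd p)) \<le> N \<and> length (b (last p)) \<le> N \<and> wt l (ext p) \<le> wt l p + (K1 + K2)"
    if p: "p \<in> Q" for p
  proof -
    obtain u w where w: "awalk u p w" "p \<noteq> []" "v \<notin> tail G ` set (tl p)" using p by (auto simp: Q_def)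
    have arcs: "hd p \<in> arcs G" "last p \<in> arcs G"
      using awalk_arcs[OF w(1)] hd_in_set[OF w(2)] last_in_set[OF w(2)] by auto
    have wa: "awalk v (a (hd p)) u"
      using a[OF arcs(1)] awalk_hd[OF w(1,2)] by (auto simp: awalk_simps)
    have wb: "awalk w (b (last p)) v"
      using b[OF arcs(2)] awalk_last[OF w(1,2)] by simp
    have "awalk v (ext p) v" unfolding ext_def
      using wa w(1) wb by (blast intro: awalk_appendI)
    moreover have "v \<notin> tail G ` set (tl (ext p))"
    proof (cases "a (hd p)")
      case Nil
      then show ?thesis using w b[OF arcs(2)] by (auto simp: ext_def)
    next
      case (Cons x xs)
      obtain y ys where "p = y # ys" using w(2) by (cases p) auto
      then show ?thesis using w b[OF arcs(2)] a[OF arcs(1)] Cons by (auto simp: ext_def)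
    qed
    ultimately have "ext p \<in> R" using w(2) by (simp add: R_def ext_def)
    moreover have "wt l (ext p) \<le> wt l p + (K1 + K2)"
      using a[OF arcs(1)] b[OF arcs(2)] by (simp add: ext_def)
    moreover have "length (a (hd p)) \<le> N"
      using N[OF awalk_arcs[OF wa]] a[OF arcs(1)] K2 by simp
    moreover have "length (b (last p)) \<le> N"
      using N[OF awalk_arcs[OF wb]] b[OF arcs(2)] K1 by simp
    ultimately show ?thesis by blast
  qed
  have 1: "sum_le (\<lambda>_. 1) ({..N} \<times> {..N}) (real (card ({..N} \<times> {..N})))"
  proof (rule sum_leI)
    fix F :: "(nat \<times> nat) set" assume "F \<subseteq> {..N} \<times> {..N}"
    then have "card F \<le> card ({..N} \<times> {..N})" by (intro card_mono) auto
    then show "(\<Sum>_\<in>F. 1) \<le> real (card ({..N} \<times> {..N}))" unfolding sum_constant by (simp only: mult_1_right of_nat_le_iff)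
  qed
  have "sum_le (\<lambda>p. exp (- h * wt l p)) Q (exp (h * (K1 + K2)) * (1 * real (card ({..N} \<times> {..N}))))"
  proof (rule sum_le_inj[OF sum_le_Times[OF sum_R 1], of F])
    show "inj_on F Q"
      by (rule inj_on_inverseI[of _ "\<lambda>(r, i, j). drop i (take (length r - j) r)"])
        (simp add: F_def ext_def)
    show "F ` Q \<subseteq> R \<times> {..N} \<times> {..N}" using main by (auto simp: F_def)
    fix p assume "p \<in> Q"
    then have "h * wt l (ext p) \<le> h * (wt l p + (K1 + K2))"
      using main h_nonneg by (intro mult_left_mono) auto
    then show "exp (- h * wt l p) \<le> exp (h * (K1 + K2)) * (case F p of (r, y) \<Rightarrow> exp (- h * wt l r) * 1)"
      by (simp add: F_def mult_exp_exp algebra_simps)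
  qed auto
  then show thesis using that by blast
qed

text \<open>The levels are disjoint and share the finite total \<open>B\<close>, so they cannot all
  have weight above 1/2.\<close>

lemma light_level:
  obtains k where "0 < k" "sum_le (\<lambda>p. exp (- h * wt l p)) {p \<in> Q. length p = k} (1/2)"
proof -
  obtain B where B: "sum_le (\<lambda>p. exp (- h * wt l p)) Q B" using sum_Q_h by blast
  have "\<exists>k>0. sum_le (\<lambda>p. exp (- h * wt l p)) {p \<in> Q. length p = k} (1/2)"
  proof (rule ccontr)
    assume "\<not> ?thesis"
    then have "\<forall>n. \<exists>F. finite F \<and> F \<subseteq> {p \<in> Q. length p = Suc n} \<and> 1/2 < (\<Sum>p\<in>F. exp (- h * wt l p))"
      unfolding sum_le_def by (simp add: not_le) blast
    from choice[OF this] obtain F where F': "\<forall>n. finite (F n) \<and> F n \<subseteq> {p \<in> Q. length p = Suc n} \<and>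
      1/2 < (\<Sum>p\<in>F n. exp (- h * wt l p))" ..
    have F: "\<And>n. finite (F n)" "\<And>n. F n \<subseteq> {p \<in> Q. length p = Suc n}"
      "\<And>n. 1/2 < (\<Sum>p\<in>F n. exp (- h * wt l p))" using F' by simp_all
    obtain N :: nat where N: "2 * B < real N" using reals_Archimedean2 by blast
    have "real N * (1/2) \<le> (\<Sum>n<N. \<Sum>p\<in>F n. exp (- h * wt l p))"
      using sum_bounded_below[of "{..<N}" "1/2" "\<lambda>n. \<Sum>p\<in>F n. exp (- h * wt l p)"] F(3)
      by (simp add: less_imp_le)
    also have "\<dots> = (\<Sum>p\<in>(\<Union>n<N. F n). exp (- h * wt l p))"
    proof (rule sum.UNION_disjoint[symmetric])
      show "\<forall>i\<in>{..<N}. \<forall>j\<in>{..<N}. i \<noteq> j \<longrightarrow> F i \<inter> F j = {}"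
      proof (intro ballI impI equals0I)
        fix i j p assume "i \<noteq> j" "p \<in> F i \<inter> F j"
        then show False using subsetD[OF F(2)[of i], of p] subsetD[OF F(2)[of j], of p] by simp
      qed
    qed (use F(1) in auto)
    also have "\<dots> \<le> B"
      using F(1) by (intro sum_leD[OF B] finite_UN_I UN_least order_trans[OF F(2)]) auto
    finally show False using N by simp
  qed
  then show thesis using that by blast
qed

text \<open>Convexity of \<open>exp\<close> interpolates between exponent \<open>h\<close>, where
  the level has weight at most 1/2, and \<open>h / 2\<close>, where \<open>G1\<close> still makes it
  finite.\<close>

lemma light_level_below_h:
  obtains k s where "0 < k" "0 < s" "s < h"
    "sum_le (\<lambda>p. exp (- s * wt l p)) {p \<in> Q. length p = k} (3/4)"
proof -
  obtain k where k: "0 < k" "sum_le (\<lambda>p. exp (- h * wt l p)) {p \<in> Q. length p = k} (1/2)"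
    using light_level by blast
  let ?Y = "E (h / 2) ^ k"
  have Y: "sum_le (\<lambda>p. exp (- (h / 2) * wt l p)) {p \<in> Q. length p = k} ?Y"
    by (rule sum_le_subset[OF sum_le_words]) (use h_pos in \<open>auto dest: subsetD[OF Q_arcs]\<close>)
  have Y0: "0 \<le> ?Y" by (rule sum_le_nonneg[OF Y])
  \<comment> \<open>Chosen so that the part from exponent \<open>h / 2\<close> contributes at most
    1/4, for a total of at most 1/2 + 1/4.\<close>
  define t where "t = 1 / (4 * (?Y + 1))"
  have t: "0 < t" "t < 1" "t * ?Y \<le> 1/4" using Y0 by (auto simp: t_def field_simps)
  define s where "s = (1 - t) * h + t * (h / 2)"
  have s_eq: "s = h - h * t / 2" by (simp add: s_def field_simps)
  have th: "0 < h * t" "h * t < h" using t h_pos by auto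
  have s: "0 < s" "s < h" unfolding s_eq using th h_pos by auto
  have convex: "exp (- s * x) \<le> (1 - t) * exp (- h * x) + t * exp (- (h / 2) * x)" for x
    using convex_onD[OF exp_convex, of t "- h * x" "- (h / 2) * x"] t
    by (simp add: s_def algebra_simps)
  have 1: "sum_le (\<lambda>p. (1 - t) * exp (- h * wt l p)) {p \<in> Q. length p = k} ((1 - t) * (1/2))"
    by (rule sum_le_dominated[OF k(2)]) (use t in auto)
  have 2: "sum_le (\<lambda>p. t * exp (- (h / 2) * wt l p)) {p \<in> Q. length p = k} (t * ?Y)"
    by (rule sum_le_dominated[OF Y]) (use t in auto)
  have "sum_le (\<lambda>p. exp (- s * wt l p)) {p \<in> Q. length p = k} (1 * ((1 - t) * (1/2) + t * ?Y))"
    by (rule sum_le_dominated[OF sum_le_add[OF 1 2]]) (use convex in auto)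
  then have "sum_le (\<lambda>p. exp (- s * wt l p)) {p \<in> Q. length p = k} (3/4)"
  proof (rule sum_le_weaken)
    have "(1 - t) * (1/2) \<le> 1/2" using t by simp
    from add_mono[OF this t(3)] show "1 * ((1 - t) * (1/2) + t * ?Y) \<le> 3/4" by simp
  qed
  then show thesis using that k s by blast
qed

lemma Q_split:
  assumes "p @ q \<in> Q" "p \<noteq> []" "q \<noteq> []"
  shows "p \<in> Q" "q \<in> Q"
proof -
  obtain u w where "awalk u (p @ q) w" "v \<notin> tail G ` set (tl (p @ q))"
    using assms(1) by (auto simp: Q_def)
  then show "p \<in> Q" "q \<in> Q"
    using assms(2,3) unfolding Q_def by (auto dest: list.set_sel(2))
qed

lemma Q_blocks:
  assumes "0 < k" "p \<in> Q"
  shows "\<exists>ps r. p = concat ps @ r \<and> set ps \<subseteq> {p \<in> Q. length p = k} \<and> set r \<subseteq> arcs G \<and> length r < k"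
  using assms(2)
proof (induction p rule: length_induct)
  case (1 p)
  consider "length p < k" | "length p = k" | "k < length p" by linarith
  then show ?case
  proof cases
    case 1
    then have "p = concat [] @ p \<and> set [] \<subseteq> {p \<in> Q. length p = k} \<and> set p \<subseteq> arcs G \<and> length p < k"
      using Q_arcs[OF "1.prems"] by simp
    then show ?thesis by blast
  next
    case 2
    then have "p = concat [p] @ [] \<and> set [p] \<subseteq> {p \<in> Q. length p = k} \<and> set [] \<subseteq> arcs G \<and> length [] < k"
      using assms(1) "1.prems" by simp
    then show ?thesis by blast
  next
    case 3
    have "p \<noteq> []" using 3 by auto
    then have *: "take k p \<in> Q" "drop k p \<in> Q"
      using Q_split[of "take k p" "drop k p"] "1.prems" 3 assms(1) by auto
    have "length (drop k p) < length p" using 3 assms(1) by simp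
    from "1.IH"[rule_format, OF this *(2)] obtain ps r where
      split: "drop k p = concat ps @ r" "set ps \<subseteq> {p \<in> Q. length p = k}" "set r \<subseteq> arcs G" "length r < k"
      by (elim exE conjE) (rule that)
    have "p = concat (take k p # ps) @ r"
      using append_take_drop_id[of k p] split(1) by simp
    moreover have "set (take k p # ps) \<subseteq> {p \<in> Q. length p = k}"
      using *(1) 3 split(2) by simp
    ultimately show ?thesis using split(3,4) by blast
  qed
qed

text \<open>The spectral gap. Every path in \<open>Q\<close> is encoded by its blocks of length
  \<open>k\<close> and a remainder: the block lists form a geometric series of ratio 3/4, and the
  remainders have finitely many possible lengths.\<close>

lemma sum_R_below_h:
  obtains s B where "0 < s" "s < h" "sum_le (\<lambda>r. exp (- s * wt l r)) R B"
proof -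
  obtain k s where k: "0 < k" and s: "0 < s" "s < h"
    and level: "sum_le (\<lambda>p. exp (- s * wt l p)) {p \<in> Q. length p = k} (3/4)"
    using light_level_below_h by blast
  have 1: "sum_le (\<lambda>ps. exp (wt (\<lambda>p. - s * wt l p) ps)) {ps. set ps \<subseteq> {p \<in> Q. length p = k}} (1 / (1 - 3/4))"
    by (rule sum_le_lists[OF level]) simp
  let ?b = "\<lambda>n. if n < k then E s ^ n else 0"
  have 2: "sum_le (\<lambda>r. exp (- s * wt l r)) {r. set r \<subseteq> arcs G \<and> length r < k} (suminf ?b)"
  proof (rule sum_le_levels[where N = length])
    fix n
    show "sum_le (\<lambda>r. exp (- s * wt l r)) {r \<in> {r. set r \<subseteq> arcs G \<and> length r < k}. length r = n} (?b n)"
    proof (cases "n < k")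
      case True
      show ?thesis using True by (simp, intro sum_le_subset[OF sum_le_words[OF s(1), of n, simplified]]) auto
    next
      case False
      then have empty: "{r \<in> {r. set r \<subseteq> arcs G \<and> length r < k}. length r = n} = {}" by auto
      show ?thesis unfolding empty using False by (simp add: sum_le_def)
    qed
    show "summable ?b" by (rule summable_finite[of "{..<k}"]) auto
  qed
  have "\<exists>x. p = concat (fst x) @ snd x \<and> set (fst x) \<subseteq> {p \<in> Q. length p = k} \<and>
      set (snd x) \<subseteq> arcs G \<and> length (snd x) < k" if "p \<in> Q" for p
    using Q_blocks[OF k that] by simp
  then have "\<forall>p\<in>Q. \<exists>x. p = concat (fst x) @ snd x \<and> set (fst x) \<subseteq> {p \<in> Q. length p = k} \<and>
      set (snd x) \<subseteq> arcs G \<and> length (snd x) < k" by (rule ballI)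
  from bchoice[OF this] obtain f where f: "\<forall>p\<in>Q. p = concat (fst (f p)) @ snd (f p) \<and>
      set (fst (f p)) \<subseteq> {p \<in> Q. length p = k} \<and> set (snd (f p)) \<subseteq> arcs G \<and> length (snd (f p)) < k" ..
  have "sum_le (\<lambda>p. exp (- s * wt l p)) Q (1 * ((1 / (1 - 3/4)) * suminf ?b))"
  proof (rule sum_le_inj[OF sum_le_Times[OF 1 2], of f])
    show "inj_on f Q" 
    proof (rule inj_onI)
      fix p q assume "p \<in> Q" "q \<in> Q" "f p = f q"
      then show "p = q" using bspec[OF f, of p] bspec[OF f, of q] by simp
    qed
    show "f ` Q \<subseteq> {ps. set ps \<subseteq> {p \<in> Q. length p = k}} \<times> {r. set r \<subseteq> arcs G \<and> length r < k}"
    proof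
      fix x assume "x \<in> f ` Q"
      then obtain p where "p \<in> Q" "x = f p" by blast
      with bspec[OF f \<open>p \<in> Q\<close>] show "x \<in> {ps. set ps \<subseteq> {p \<in> Q. length p = k}} \<times> {r. set r \<subseteq> arcs G \<and> length r < k}"
        by (simp add: mem_Times_iff)
    qed
    fix p assume p: "p \<in> Q"
    obtain ps r where pr: "f p = (ps, r)" by (cases "f p")
    have p_eq: "p = concat ps @ r" using bspec[OF f p] by (simp add: pr)
    have "exp (- s * wt l p) = exp (- s * wt (wt l) ps) * exp (- s * wt l r)"
      by (simp add: p_eq wt_concat mult_exp_exp algebra_simps)
    then show "exp (- s * wt l p) \<le> 1 * (case f p of (ps, r) \<Rightarrow> exp (wt (\<lambda>p. - s * wt l p) ps) * exp (- s * wt l r))"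
      unfolding pr wt_scale by simp
  qed auto
  then have "sum_le (\<lambda>r. exp (- s * wt l r)) R (1 * ((1 / (1 - 3/4)) * suminf ?b))"
    by (rule sum_le_subset[OF _ R_subset_Q])
  then show thesis using that s by blast
qed

end

section \<open>Exponential moments and deviations\<close>

text \<open>From \<open>exp x - 1 \<le> x * exp x\<close>, whose right side is
  \<open>x + x * (exp x - 1)\<close>; the last product is of second order.\<close>

lemma exp_le_second_order: "exp x \<le> 1 + x + x\<^sup>2 * exp \<bar>x\<bar>" for x :: real
proof -
  have "exp x * (1 - x) \<le> exp x * exp (- x)"
    using exp_ge_add_one_self[of "- x"] by (intro mult_left_mono) auto
  then have first: "exp x - 1 \<le> x * exp x" by (simp add: mult_exp_exp algebra_simps)
  have "x * (exp x - 1) \<le> x\<^sup>2 * exp \<bar>x\<bar>"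
  proof (cases "0 \<le> x")
    case True
    then have "x * (exp x - 1) \<le> x * (x * exp x)" using first by (intro mult_left_mono)
    then show ?thesis using True by (simp add: power2_eq_square)
  next
    case False
    have "(- x) * (1 - exp x) \<le> (- x) * (- x)"
      using False exp_ge_add_one_self[of x] by (intro mult_left_mono) linarith+
    also have "\<dots> \<le> x\<^sup>2 * exp \<bar>x\<bar>" by (simp add: power2_eq_square mult_le_cancel_left1)
    finally show ?thesis by (simp add: algebra_simps)
  qed
  then show ?thesis using first by (simp add: algebra_simps)
qed

lemma wt_add: "wt (\<lambda>e. f e + g e) p = wt f p + wt g p"
  by (simp add: sum_list_addf)

context length_graph
begin

lemma abs_wt_le:
  assumes "\<And>e. e \<in> arcs G \<Longrightarrow> \<bar>f e\<bar> \<le> B * l e" "set p \<subseteq> arcs G"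
  shows "\<bar>wt f p\<bar> \<le> B * wt l p"
  using assms(2)
proof (induction p)
  case (Cons e p)
  then show ?case using assms(1)[of e] by (simp add: algebra_simps)
qed simp

lemma R_arcs: "r \<in> R \<Longrightarrow> set r \<subseteq> arcs G"
  using R_subset_P P_arcs by blast

text \<open>The weighted mean of \<open>f\<close> over first returns without normalisation, which
  cancels in the ratio defining \<open>\<Lambda>\<close>.\<close>

definition Z :: "('e \<Rightarrow> real) \<Rightarrow> real" where
  "Z f = (\<Sum>\<^sub>\<infinity>r\<in>R. wt f r * exp (- h * wt l r))"

text \<open>The spectral gap absorbs the factor linear in the length:
  \<open>x \<le> exp ((h - s) * x) / (h - s)\<close>.\<close>

lemma summable_Z:
  assumes "\<And>e. e \<in> arcs G \<Longrightarrow> \<bar>f e\<bar> \<le> B * l e" "0 \<le> B"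
  shows "(\<lambda>r. wt f r * exp (- h * wt l r)) summable_on R"
proof -
  obtain s B' where s: "0 < s" "s < h" "sum_le (\<lambda>r. exp (- s * wt l r)) R B'"
    using sum_R_below_h by blast
  have "sum_le (\<lambda>r. norm (wt f r * exp (- h * wt l r))) R (B / (h - s) * B')"
  proof (rule sum_le_dominated[OF s(3)])
    fix r assume r: "r \<in> R"
    have "(h - s) * wt l r \<le> exp ((h - s) * wt l r)"
      using exp_ge_add_one_self[of "(h - s) * wt l r"] by linarith
    then have "wt l r \<le> exp ((h - s) * wt l r) / (h - s)" using s by (simp add: field_simps)
    then have "\<bar>wt f r\<bar> \<le> B * (exp ((h - s) * wt l r) / (h - s))"
      using abs_wt_le[OF assms(1) R_arcs[OF r]] assms(2) by (meson mult_left_mono order_trans)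
    then have "\<bar>wt f r\<bar> * exp (- h * wt l r) \<le> B * (exp ((h - s) * wt l r) / (h - s)) * exp (- h * wt l r)"
      by (rule mult_right_mono) simp
    also have "\<dots> = B / (h - s) * exp (- s * wt l r)" by (simp add: mult_exp_exp algebra_simps)
    finally show "norm (wt f r * exp (- h * wt l r)) \<le> B / (h - s) * exp (- s * wt l r)"
      by (simp add: abs_mult)
  qed (use s assms(2) in auto)
  then have "(\<lambda>r. norm (wt f r * exp (- h * wt l r))) summable_on R"
    by (rule sum_le_summable) simp
  then show ?thesis by (rule abs_summable_summable)
qed

text \<open>Some first return path uses \<open>e\<close>; its term is positive and all others are
  nonnegative.\<close>

lemma Z_pos:
  assumes bound: "\<And>e. e \<in> arcs G \<Longrightarrow> \<bar>f e\<bar> \<le> B * l e" "0 \<le> B"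
    and nonneg: "\<And>e. e \<in> arcs G \<Longrightarrow> 0 \<le> f e" and e: "e \<in> arcs G" "f e \<noteq> 0"
  shows "0 < Z f"
proof -
  have wt_nonneg: "0 \<le> wt f p" if "set p \<subseteq> arcs G" for p
    using nonneg that by (intro sum_list_nonneg) auto
  obtain a where a: "awalk v (a @ [e]) (head G e)" "v \<notin> tail G ` set (tl (a @ [e]))"
    using walks_from_v e(1) by metis
  obtain b where b: "awalk (head G e) b v" "v \<notin> tail G ` set b"
    using walks_to_v e(1) by metis
  have r: "(a @ [e]) @ b \<in> R"
    using awalk_appendI[OF a(1) b(1)] a(2) b(2) unfolding R_def by (cases a) auto
  have arcs: "set a \<subseteq> arcs G" "set b \<subseteq> arcs G" using R_arcs[OF r] by auto
  have "0 < wt f ((a @ [e]) @ b)"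
    using wt_nonneg[OF arcs(1)] wt_nonneg[OF arcs(2)] nonneg[OF e(1)] e(2) by simp
  then have "0 < wt f ((a @ [e]) @ b) * exp (- h * wt l ((a @ [e]) @ b))" by simp
  also have "\<dots> \<le> Z f"
    unfolding Z_def
    using summable_Z[OF bound] wt_nonneg r
    by (intro sum_le_point[OF summable_sum_le[where A = R]]) (auto dest: R_arcs)
  finally show ?thesis .
qed

lemma Z_l_pos: "0 < Z l"
proof -
  obtain d where "d \<in> arcs G" using arc_out_of_v by blast
  then show ?thesis using l_pos less_imp_neq[OF l_pos] by (intro Z_pos[of l 1 d]) (auto intro: less_imp_le)
qed

text \<open>To first order the sum over \<open>R\<close> is at most
  \<open>1 + \<theta> * Z b\<close>, and the gap controls the quadratic error, so for small
  \<open>\<theta>\<close> it is below 1. Decomposition into first returns then gives a convergent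
  geometric series over \<open>P\<close>.\<close>

lemma exponential_moment:
  assumes bound: "\<And>e. e \<in> arcs G \<Longrightarrow> \<bar>b e\<bar> \<le> B * l e" "0 < B" and neg: "Z b < 0"
  obtains \<theta>0 where "0 < \<theta>0" "\<And>\<theta>. 0 < \<theta> \<Longrightarrow> \<theta> \<le> \<theta>0 \<Longrightarrow>
    \<exists>M>0. sum_le (\<lambda>p. exp (- h * wt l p + \<theta> * wt b p)) P M"
proof -
  obtain s B' where s: "0 < s" "s < h" "sum_le (\<lambda>r. exp (- s * wt l r)) R B'"
    using sum_R_below_h by blast
  define d where "d = h - s"
  have d: "0 < d" using s by (simp add: d_def)
  have B': "0 \<le> B'" by (rule sum_le_nonneg[OF s(3)])
  define K where "K = B\<^sup>2 * (4 / d)\<^sup>2"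
  have K: "0 \<le> K" by (simp add: K_def)
  have "((\<lambda>r. wt b r * exp (- h * wt l r)) has_sum Z b) R"
    unfolding Z_def using bound by (intro has_sum_infsum summable_Z[of b B]) auto
  then have "\<forall>\<^sub>F F in finite_subsets_at_top R. (\<Sum>r\<in>F. wt b r * exp (- h * wt l r)) < Z b / 2"
    unfolding has_sum_def by (rule order_tendstoD(2)) (use neg in simp)
  then obtain F0 where F0: "finite F0" "F0 \<subseteq> R" "\<And>F. finite F \<Longrightarrow> F0 \<subseteq> F \<Longrightarrow> F \<subseteq> R \<Longrightarrow>
      (\<Sum>r\<in>F. wt b r * exp (- h * wt l r)) < Z b / 2"
    unfolding eventually_finite_subsets_at_top by auto
  \<comment> \<open>The first bound gives
    \<open>\<bar>\<theta> * wt b r\<bar> \<le> d / 2 * wt l r\<close>; the second keeps the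
    quadratic error below half of the negative linear term
    \<open>\<theta> * (Z b / 2)\<close>.\<close>
  define \<theta>0 where "\<theta>0 = min (d / (2 * B)) (- Z b / (4 * (K * B' + 1)))"
  have KB: "0 < 4 * (K * B' + 1)" using K B' by (simp add: add_nonneg_pos)
  have \<theta>0: "0 < \<theta>0" using d bound(2) neg KB by (simp add: \<theta>0_def divide_neg_pos)
  show thesis
  proof (rule that[OF \<theta>0])
    fix \<theta> :: real assume \<theta>: "0 < \<theta>" "\<theta> \<le> \<theta>0"
    have \<theta>B: "\<theta> * B \<le> d / 2" using \<theta>(2) bound(2) by (simp add: \<theta>0_def field_simps)
    have "\<theta> \<le> - Z b / (4 * (K * B' + 1))" using \<theta>(2) by (simp add: \<theta>0_def)
    then have "\<theta> * (4 * (K * B' + 1)) \<le> - Z b" unfolding pos_le_divide_eq[OF KB] .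
    then have \<theta>K: "\<theta> * (K * B') \<le> - Z b / 4" using \<theta>(1) by (simp add: algebra_simps)
    have second_order: "exp (- h * wt l r + \<theta> * wt b r) \<le>
        exp (- h * wt l r) + \<theta> * (wt b r * exp (- h * wt l r)) + \<theta>\<^sup>2 * K * exp (- s * wt l r)"
      if r: "r \<in> R" for r
    proof -
      let ?L = "wt l r" and ?x = "\<theta> * wt b r"
      have L: "0 \<le> ?L" using wt_l_nonneg[OF R_arcs[OF r]] .
      have "\<bar>?x\<bar> = \<theta> * \<bar>wt b r\<bar>" using \<theta> by (simp add: abs_mult)
      also have "\<dots> \<le> \<theta> * (B * ?L)"
        using abs_wt_le[OF bound(1) R_arcs[OF r]] \<theta> by (intro mult_left_mono) auto
      finally have x: "\<bar>?x\<bar> \<le> \<theta> * B * ?L" by simp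
      also have "\<dots> \<le> d / 2 * ?L" using \<theta>B L by (rule mult_right_mono)
      finally have x': "\<bar>?x\<bar> \<le> d / 2 * ?L" .
      \<comment> \<open>The gap \<open>d\<close> is spent in two halves: one on
        \<open>exp \<bar>?x\<bar>\<close>, the other on \<open>?x\<^sup>2\<close>, that is
        \<open>d / 4\<close> for each factor \<open>?x\<close>.\<close>
      have "d / 4 * ?L \<le> exp (d / 4 * ?L)" using exp_ge_add_one_self[of "d / 4 * ?L"] by linarith
      then have "?L \<le> 4 / d * exp (d / 4 * ?L)" using d by (simp add: field_simps)
      with x have "\<bar>?x\<bar> \<le> \<theta> * B * (4 / d * exp (d / 4 * ?L))"
        using \<theta> bound(2) by (meson mult_left_mono mult_nonneg_nonneg less_imp_le order_trans)
      then have "\<bar>?x\<bar>\<^sup>2 \<le> (\<theta> * B * (4 / d * exp (d / 4 * ?L)))\<^sup>2" by (rule power_mono) simp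
      also have "\<dots> = \<theta>\<^sup>2 * K * exp (d / 2 * ?L)"
        by (simp add: K_def power_mult_distrib power_divide exp_double[symmetric])
      finally have x2: "?x\<^sup>2 \<le> \<theta>\<^sup>2 * K * exp (d / 2 * ?L)" by simp
      have "exp ?x \<le> 1 + ?x + ?x\<^sup>2 * exp \<bar>?x\<bar>" by (rule exp_le_second_order)
      also have "?x\<^sup>2 * exp \<bar>?x\<bar> \<le> (\<theta>\<^sup>2 * K * exp (d / 2 * ?L)) * exp (d / 2 * ?L)"
        using x2 x' K by (intro mult_mono) auto
      also have "\<dots> = \<theta>\<^sup>2 * K * exp (d * ?L)" by (simp add: mult.assoc mult_exp_exp)
      finally have "exp ?x \<le> 1 + ?x + \<theta>\<^sup>2 * K * exp (d * ?L)" by simp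
      then have "exp (- h * ?L) * exp ?x \<le> exp (- h * ?L) * (1 + ?x + \<theta>\<^sup>2 * K * exp (d * ?L))"
        by (rule mult_left_mono) simp
      also have "\<dots> = exp (- h * ?L) + \<theta> * (wt b r * exp (- h * ?L)) + \<theta>\<^sup>2 * K * (exp (- h * ?L) * exp (d * ?L))"
        by (simp add: algebra_simps)
      also have "exp (- h * ?L) * exp (d * ?L) = exp (- s * ?L)"
        by (simp add: mult_exp_exp d_def algebra_simps)
      finally show ?thesis by (simp add: mult_exp_exp)
    qed
    define q where "q = 1 + \<theta> * (Z b / 4)"
    have q: "q < 1" using \<theta> neg by (simp add: q_def mult_pos_neg)
    have "sum_le (\<lambda>r. exp (- h * wt l r + \<theta> * wt b r)) R q"
    proof (rule sum_leI)
      fix F assume F: "finite F" "F \<subseteq> R"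
      \<comment> \<open>The linear term is known to be below \<open>Z b / 2\<close> only for sets
        containing \<open>F0\<close>; enlarging \<open>F\<close> is harmless, as the exponentials
        are positive.\<close>
      let ?F = "F \<union> F0"
      have F': "finite ?F" "?F \<subseteq> R" using F F0 by auto
      have "(\<Sum>r\<in>F. exp (- h * wt l r + \<theta> * wt b r)) \<le> (\<Sum>r\<in>?F. exp (- h * wt l r + \<theta> * wt b r))"
        using F' by (intro sum_mono2) auto
      also have "\<dots> \<le> (\<Sum>r\<in>?F. exp (- h * wt l r) + \<theta> * (wt b r * exp (- h * wt l r)) + \<theta>\<^sup>2 * K * exp (- s * wt l r))"
        using F' by (intro sum_mono second_order) auto
      also have "\<dots> = (\<Sum>r\<in>?F. exp (- h * wt l r)) + \<theta> * (\<Sum>r\<in>?F. wt b r * exp (- h * wt l r))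
          + \<theta>\<^sup>2 * K * (\<Sum>r\<in>?F. exp (- s * wt l r))"
        by (simp add: sum.distrib sum_distrib_left)
      also have "\<dots> \<le> 1 + \<theta> * (Z b / 2) + \<theta>\<^sup>2 * K * B'"
        using \<theta> K F0(3)[OF F'(1) _ F'(2)] sum_leD[OF sum_R F'] sum_leD[OF s(3) F']
        by (intro add_mono mult_left_mono) auto
      also have "\<dots> = 1 + \<theta> * (Z b / 2 + \<theta> * (K * B'))" by (simp add: power2_eq_square algebra_simps)
      also have "\<dots> \<le> q"
        unfolding q_def using \<theta>K \<theta> by (intro add_left_mono mult_left_mono) auto
      finally show "(\<Sum>r\<in>F. exp (- h * wt l r + \<theta> * wt b r)) \<le> q" .
    qed
    then have lists: "sum_le (\<lambda>ps. exp (wt (\<lambda>r. - h * wt l r + \<theta> * wt b r) ps)) {ps. set ps \<subseteq> R} (1 / (1 - q))"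
      using q by (rule sum_le_lists)
    from P_decomp have "\<forall>p\<in>P. \<exists>ps. p = concat ps \<and> set ps \<subseteq> R" by blast
    from bchoice[OF this] obtain g where g: "\<forall>p\<in>P. p = concat (g p) \<and> set (g p) \<subseteq> R" ..
    have "sum_le (\<lambda>p. exp (- h * wt l p + \<theta> * wt b p)) P (1 * (1 / (1 - q)))"
    proof (rule sum_le_inj[OF lists, of g])
      show "inj_on g P"
      proof (rule inj_onI)
        fix p p' assume "p \<in> P" "p' \<in> P" "g p = g p'"
        then show "p = p'" using bspec[OF g, of p] bspec[OF g, of p'] by metis
      qed
      show "g ` P \<subseteq> {ps. set ps \<subseteq> R}" using g by blast
      fix p assume "p \<in> P"
      then have p: "p = concat (g p)" using g by blast
      have "wt (\<lambda>r. - h * wt l r + \<theta> * wt b r) (g p) = - h * wt (wt l) (g p) + \<theta> * wt (wt b) (g p)"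
        unfolding wt_add wt_scale ..
      also have "\<dots> = - h * wt l p + \<theta> * wt b p"
        using arg_cong[OF p, of "wt l"] arg_cong[OF p, of "wt b"] by (simp only: wt_concat)
      finally show "exp (- h * wt l p + \<theta> * wt b p) \<le> 1 * exp (wt (\<lambda>r. - h * wt l r + \<theta> * wt b r) (g p))"
        by simp
    qed simp
    then show "\<exists>M>0. sum_le (\<lambda>p. exp (- h * wt l p + \<theta> * wt b p)) P M"
      using q by (intro exI[of _ "1 / (1 - q)"]) auto
  qed
qed

lemma Z_shift:
  assumes "\<And>e. e \<in> arcs G \<Longrightarrow> \<bar>c e\<bar> \<le> B * l e" "0 \<le> B"
  shows "Z (\<lambda>e. x * c e + y * l e) = x * Z c + y * Z l"
proof -
  have 1: "(\<lambda>r. wt c r * exp (- h * wt l r)) summable_on R" by (rule summable_Z[OF assms])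
  have 2: "(\<lambda>r. wt l r * exp (- h * wt l r)) summable_on R"
    by (rule summable_Z[of _ 1]) (use l_pos less_imp_le in force)+
  have "Z (\<lambda>e. x * c e + y * l e) =
      (\<Sum>\<^sub>\<infinity>r\<in>R. x * (wt c r * exp (- h * wt l r)) + y * (wt l r * exp (- h * wt l r)))"
    unfolding Z_def wt_add wt_scale by (rule infsum_cong) (simp add: algebra_simps)
  also have "\<dots> = x * Z c + y * Z l"
    unfolding Z_def using 1 2
    by (subst infsum_add) (auto intro: summable_on_cmult_right simp: infsum_cmult_right)
  finally show ?thesis .
qed

section \<open>Exponentially rare deviations\<close>

definition thin :: "(real \<Rightarrow> nat) \<Rightarrow> bool" where
  "thin f \<longleftrightarrow> (\<exists>C d. 0 < C \<and> 0 < d \<and> (\<forall>T>0. real (f T) \<le> C * exp ((h - d) * T)))"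

lemma thinI:
  "0 < C \<Longrightarrow> 0 < d \<Longrightarrow> (\<And>T. 0 < T \<Longrightarrow> real (f T) \<le> C * exp ((h - d) * T)) \<Longrightarrow> thin f"
  unfolding thin_def by (intro exI[of _ C] exI[of _ d]) simp

lemma thin_mono: "thin g \<Longrightarrow> (\<And>T. 0 < T \<Longrightarrow> f T \<le> g T) \<Longrightarrow> thin f"
  unfolding thin_def by (meson of_nat_mono order_trans)

lemma thin_add:
  assumes "thin f" "thin g"
  shows "thin (\<lambda>T. f T + g T)"
proof -
  from assms obtain C1 d1 C2 d2 where
    1: "0 < C1" "0 < d1" "\<forall>T>0. real (f T) \<le> C1 * exp ((h - d1) * T)" and
    2: "0 < C2" "0 < d2" "\<forall>T>0. real (g T) \<le> C2 * exp ((h - d2) * T)"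
    unfolding thin_def by (elim exE conjE) (rule that)
  show ?thesis
  proof (rule thinI[of "C1 + C2" "min d1 d2"])
    fix T :: real assume T: "0 < T"
    have "real (f T + g T) \<le> C1 * exp ((h - d1) * T) + C2 * exp ((h - d2) * T)"
      using 1(3) 2(3) T by (simp add: add_mono)
    also have "\<dots> \<le> C1 * exp ((h - min d1 d2) * T) + C2 * exp ((h - min d1 d2) * T)"
      using 1(1) 2(1) T by (intro add_mono mult_left_mono) (auto intro!: mult_right_mono)
    finally show "real (f T + g T) \<le> (C1 + C2) * exp ((h - min d1 d2) * T)" by (simp add: algebra_simps)
  qed (use 1 2 in auto)
qed

lemma thin_sum: "finite A \<Longrightarrow> (\<And>i. i \<in> A \<Longrightarrow> thin (f i)) \<Longrightarrow> thin (\<lambda>T. \<Sum>i\<in>A. f i T)"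
  by (induction A rule: finite_induct) (auto intro: thin_add thinI[of 1 1])

text \<open>
  Chernoff bound: \<open>x * c + y * l\<close> has exponential moments on \<open>P\<close> since its mean over first
  return paths, weighted by \<open>exp (- h * wt l r)\<close>, is negative.
\<close>

lemma chernoff:
  assumes c: "\<And>e. e \<in> arcs G \<Longrightarrow> \<bar>c e\<bar> \<le> B * l e" "0 \<le> B"
    and neg: "x * Z c + y * Z l < 0" and gap: "0 < \<alpha>"
    and dev: "\<And>p T. p \<in> D T \<Longrightarrow> p \<in> P \<and> wt l p < T \<and> \<alpha> * T < x * wt c p + y * wt l p + \<beta> * (T - wt l p)"
  shows "thin (\<lambda>T. card (D T))"
proof -
  define b where "b e = x * c e + y * l e" for e
  have b: "\<bar>b e\<bar> \<le> (\<bar>x\<bar> * B + \<bar>y\<bar> + 1) * l e" if "e \<in> arcs G" for e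
  proof -
    have "\<bar>b e\<bar> \<le> \<bar>x\<bar> * \<bar>c e\<bar> + \<bar>y\<bar> * \<bar>l e\<bar>"
      unfolding b_def by (metis abs_mult abs_triangle_ineq)
    also have "\<dots> \<le> \<bar>x\<bar> * (B * l e) + \<bar>y\<bar> * l e"
      using c(1)[OF that] l_pos[OF that] by (intro add_mono mult_left_mono) auto
    also have "\<dots> \<le> (\<bar>x\<bar> * B + \<bar>y\<bar> + 1) * l e"
      using l_pos[OF that] by (simp add: algebra_simps)
    finally show ?thesis .
  qed
  have Zb: "Z b < 0" unfolding b_def using Z_shift[OF c] neg by simp
  have B': "0 < \<bar>x\<bar> * B + \<bar>y\<bar> + 1" using c(2) by (intro add_nonneg_pos) auto
  obtain \<theta>0 where \<theta>0: "0 < \<theta>0" "\<And>\<theta>. 0 < \<theta> \<Longrightarrow> \<theta> \<le> \<theta>0 \<Longrightarrow>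
      \<exists>M>0. sum_le (\<lambda>p. exp (- h * wt l p + \<theta> * wt b p)) P M"
    by (rule exponential_moment[OF b B' Zb]) (assumption, rule that, assumption, blast)
  define \<theta> where "\<theta> = min \<theta>0 (h / (\<bar>\<beta>\<bar> + 1))"
  have \<theta>: "0 < \<theta>" "\<theta> \<le> \<theta>0" using \<theta>0 h_pos by (auto simp: \<theta>_def add_nonneg_pos)
  have "\<theta> \<le> h / (\<bar>\<beta>\<bar> + 1)" by (simp add: \<theta>_def)
  then have "\<theta> * (\<bar>\<beta>\<bar> + 1) \<le> h" by (subst (asm) pos_le_divide_eq) auto
  moreover have "\<theta> * \<beta> \<le> \<theta> * (\<bar>\<beta>\<bar> + 1)" using \<theta> by (intro mult_left_mono) auto
  ultimately have \<theta>\<beta>: "\<theta> * \<beta> \<le> h" by linarith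
  obtain M where M: "0 < M" "sum_le (\<lambda>p. exp (- h * wt l p + \<theta> * wt b p)) P M"
    using \<theta>0(2)[OF \<theta>] by blast
  show ?thesis
  proof (rule thinI[OF M(1), of "\<theta> * \<alpha>"])
    show "0 < \<theta> * \<alpha>" using \<theta> gap by simp
    fix T :: real
    have "real (card (D T)) * exp (- (h - \<theta> * \<alpha>) * T) \<le> M"
    proof (rule sum_le_card(2)[OF sum_le_subset[OF M(2)]])
      show "D T \<subseteq> P" using dev by blast
      fix p assume "p \<in> D T"
      then have p: "wt l p < T" "\<alpha> * T < x * wt c p + y * wt l p + \<beta> * (T - wt l p)" using dev by blast+
      have wb: "wt b p = x * wt c p + y * wt l p" unfolding b_def wt_add wt_scale ..
      have "\<theta> * (\<alpha> * T) \<le> \<theta> * (wt b p + \<beta> * (T - wt l p))"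
        using p(2) \<theta> unfolding wb by (intro mult_left_mono) auto
      moreover have "(\<theta> * \<beta>) * (T - wt l p) \<le> h * (T - wt l p)"
        using \<theta>\<beta> p(1) by (intro mult_right_mono) auto
      ultimately have "- (h - \<theta> * \<alpha>) * T \<le> - h * wt l p + \<theta> * wt b p"
        by (simp add: algebra_simps)
      then show "exp (- (h - \<theta> * \<alpha>) * T) \<le> exp (- h * wt l p + \<theta> * wt b p)" by simp
    qed simp
    then have "real (card (D T)) * exp (- (h - \<theta> * \<alpha>) * T) * exp ((h - \<theta> * \<alpha>) * T) \<le> M * exp ((h - \<theta> * \<alpha>) * T)"
      by (rule mult_right_mono) simp
    moreover have "exp (- (h - \<theta> * \<alpha>) * T) * exp ((h - \<theta> * \<alpha>) * T) = 1"
      by (simp add: mult_exp_exp algebra_simps)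
    ultimately show "real (card (D T)) \<le> M * exp ((h - \<theta> * \<alpha>) * T)"
      by (simp only: mult.assoc mult_1_right)
  qed
qed

text \<open>The two tails are \<open>\<sigma> = 1\<close> and \<open>\<sigma> = -1\<close>. Half of
  \<open>\<epsilon>\<close> makes the mean of the centred cost strictly negative, the other half is
  the gap for \<open>chernoff\<close>. Taking \<open>\<beta> = y\<close> turns
  \<open>y * wt l p + \<beta> * (T - wt l p)\<close> into \<open>y * T\<close>.\<close>

lemma deviation:
  assumes c: "\<And>e. e \<in> arcs G \<Longrightarrow> \<bar>c e\<bar> \<le> B * l e" "0 \<le> B" and \<epsilon>: "0 < \<epsilon>"
  shows "thin (\<lambda>T. card {p \<in> P. wt l p < T \<and> \<epsilon> * T < \<bar>wt c p - Z c / Z l * T\<bar>})"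
proof -
  define \<Lambda> where "\<Lambda> = Z c / Z l"
  have \<Lambda>: "Z c = \<Lambda> * Z l" using Z_l_pos by (simp add: \<Lambda>_def)
  define D where "D \<sigma> T = {p \<in> P. wt l p < T \<and> \<epsilon> * T < \<sigma> * (wt c p - \<Lambda> * T)}" for \<sigma> T :: real
  have one_sided: "thin (\<lambda>T. card (D \<sigma> T))" for \<sigma>
  proof (rule chernoff[of c B \<sigma> "- \<sigma> * \<Lambda> - \<epsilon> / 2" "\<epsilon> / 2" "D \<sigma>" "- \<sigma> * \<Lambda> - \<epsilon> / 2"])
    show "\<sigma> * Z c + (- \<sigma> * \<Lambda> - \<epsilon> / 2) * Z l < 0"
      using Z_l_pos \<epsilon> by (simp add: \<Lambda> algebra_simps)
    show "p \<in> P \<and> wt l p < T \<and> \<epsilon> / 2 * T <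
        \<sigma> * wt c p + (- \<sigma> * \<Lambda> - \<epsilon> / 2) * wt l p + (- \<sigma> * \<Lambda> - \<epsilon> / 2) * (T - wt l p)"
      if "p \<in> D \<sigma> T" for p T
      using that by (auto simp: D_def field_simps)
  qed (use c \<epsilon> in auto)
  show ?thesis
  proof (rule thin_mono[OF thin_add[OF one_sided[of 1] one_sided[of "-1"]]])
    fix T :: real
    have "{p \<in> P. wt l p < T \<and> \<epsilon> * T < \<bar>wt c p - Z c / Z l * T\<bar>} = D 1 T \<union> D (-1) T"
      unfolding D_def \<Lambda>_def by (auto simp: abs_if split: if_splits)
    then show "card {p \<in> P. wt l p < T \<and> \<epsilon> * T < \<bar>wt c p - Z c / Z l * T\<bar>} \<le> card (D 1 T) + card (D (-1) T)"
      by (simp add: card_Un_le)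
  qed
qed

text \<open>Numerator and denominator have exact rates, and thinness puts the first strictly below
  \<open>h\<close>. If \<open>adm c U\<close> is empty, the ratio is 0 and the limit is
  \<open>-\<infinity>\<close>.\<close>

lemma log_ratio_limit:
  assumes U: "open U" and thin: "thin (cnt c U)"
  shows "\<exists>L<0. ((\<lambda>T. ereal (1 / T) * elog (real (cnt c U T) / real (cnt c UNIV T))) \<longlongrightarrow> L) at_top"
proof (cases "adm c U = {}")
  case True
  have "((\<lambda>T. ereal (1 / T) * elog (real (cnt c U T) / real (cnt c UNIV T))) \<longlongrightarrow> -\<infinity>) at_top"
    by (rule tendsto_eventually, use eventually_gt_at_top[of 0] in eventually_elim)
      (simp add: cnt_eq_0[OF True] elog_def)
  then show ?thesis by (intro exI[of _ "-\<infinity>"]) simp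
next
  case False
  have adm: "adm c UNIV \<noteq> {}" using False by (auto simp: adm_def)
  obtain C d where C: "0 < C" "0 < d" "\<forall>T>0. real (cnt c U T) \<le> C * exp ((h - d) * T)"
    using thin unfolding thin_def by (elim exE conjE) (rule that)
  have rate: "rate c U \<le> h - d" by (rule rate_le[OF U False C(1)]) (use C(3) in simp)
  have "((\<lambda>T. ln (real (cnt c U T)) / T - ln (real (cnt c UNIV T)) / T) \<longlongrightarrow> rate c U - h) at_top"
    using cnt_limit[OF U False] cnt_limit[OF open_UNIV adm] unfolding rate_UNIV by (rule tendsto_diff)
  then have lim: "((\<lambda>T. ereal (ln (real (cnt c U T)) / T - ln (real (cnt c UNIV T)) / T)) \<longlongrightarrow> ereal (rate c U - h)) at_top"
    by (rule tendsto_ereal)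
  have "\<forall>\<^sub>F T in at_top. ereal (ln (real (cnt c U T)) / T - ln (real (cnt c UNIV T)) / T)
      = ereal (1 / T) * elog (real (cnt c U T) / real (cnt c UNIV T))"
    using cnt_pos(1)[OF U False] cnt_pos(1)[OF open_UNIV adm] eventually_gt_at_top[of 0]
  proof eventually_elim
    case (elim T)
    then show ?case by (simp add: elog_def ln_div diff_divide_distrib not_le)
  qed
  with lim have "((\<lambda>T. ereal (1 / T) * elog (real (cnt c U T) / real (cnt c UNIV T))) \<longlongrightarrow> ereal (rate c U - h)) at_top"
    by (rule Lim_transform_eventually)
  then show ?thesis using rate C(2) by (intro exI[of _ "ereal (rate c U - h)"]) auto
qed

end

section \<open>Vector costs and arbitrary norms\<close>

lemma is_norm_bound:
  fixes N :: "real ^ 'n::finite \<Rightarrow> real"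
  assumes N: "is_norm N" and x: "\<And>i. \<bar>x $ i\<bar> \<le> a"
  shows "N x \<le> a * (\<Sum>i\<in>UNIV. N (axis i 1))"
proof -
  have N0: "N 0 = 0" and add: "\<And>x y. N (x + y) \<le> N x + N y"
    and scale: "\<And>a x. N (a *\<^sub>R x) = \<bar>a\<bar> * N x" and nonneg: "\<And>x. 0 \<le> N x"
    using N by (auto simp: is_norm_def)
  have sum: "N (sum f A) \<le> (\<Sum>i\<in>A. N (f i))" if "finite A" for f :: "'n \<Rightarrow> real ^ 'n" and A
    using that
  proof (induction A)
    case (insert i A)
    then show ?case using add[of "f i" "sum f A"] by simp
  qed (simp add: N0)
  have "x = (\<Sum>i\<in>UNIV. x $ i *\<^sub>R axis i 1)"
    using basis_expansion[of x] by (simp add: scalar_mult_eq_scaleR)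
  then have "N x \<le> (\<Sum>i\<in>UNIV. N (x $ i *\<^sub>R axis i 1))" by (metis sum finite)
  also have "\<dots> \<le> (\<Sum>i\<in>UNIV. a * N (axis i 1))"
    unfolding scale using x nonneg by (intro sum_mono mult_right_mono)
  finally show ?thesis by (simp add: sum_distrib_left)
qed

text \<open>Makes the deviation set open, as \<open>cnt_limit\<close> requires.\<close>

lemma is_norm_continuous:
  fixes N :: "real ^ 'n::finite \<Rightarrow> real"
  assumes N: "is_norm N"
  shows "continuous_on UNIV N"
proof -
  define K where "K = (\<Sum>i\<in>UNIV. N (axis i (1::real) :: real ^ 'n))"
  have K: "0 \<le> K" unfolding K_def using N by (intro sum_nonneg) (auto simp: is_norm_def)
  have bound: "N x \<le> K * norm x" for x
    using is_norm_bound[OF N, of x "norm x"] component_le_norm_cart[of x] by (simp add: K_def mult.commute)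
  have add: "N (x + y) \<le> N x + N y" for x y using N by (simp add: is_norm_def)
  have diff: "N x - N y \<le> K * norm (x - y)" for x y
    using bound[of "x - y"] add[of "x - y" y] by simp
  have "\<bar>N x - N y\<bar> \<le> K * norm (x - y)" for x y
    using diff[of x y] diff[of y x] by (simp add: norm_minus_commute abs_le_iff)
  then have "K-lipschitz_on UNIV N"
    using K by (intro lipschitz_onI) (auto simp: dist_norm)
  then show ?thesis by (rule lipschitz_on_continuous_on)
qed

lemma wt_vec_nth: "wt (\<lambda>e. \<chi> i. c i e) p $ i = wt (c i) p"
  by (induction p) auto

text \<open>A deviation above \<open>\<epsilon>\<close> in \<open>N\<close> forces one above
  \<open>\<epsilon> / K\<close> in some coordinate, so a union bound over coordinates
  suffices.\<close>

lemma (in length_graph) vector_deviation: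
  fixes c :: "'n::finite \<Rightarrow> 'e \<Rightarrow> real" and N :: "real ^ 'n \<Rightarrow> real"
  assumes c: "\<And>i e. e \<in> arcs G \<Longrightarrow> \<bar>c i e\<bar> \<le> B i * l e" "\<And>i. 0 \<le> B i"
    and N: "is_norm N" and \<epsilon>: "0 < \<epsilon>"
  shows "thin (cnt (\<lambda>e. \<chi> i. c i e) {x. \<epsilon> < N (x - (\<chi> i. Z (c i) / Z l))})"
proof -
  define K where "K = (\<Sum>i\<in>UNIV. N (axis i (1::real) :: real ^ 'n)) + 1"
  have "0 \<le> (\<Sum>i\<in>UNIV. N (axis i (1::real) :: real ^ 'n))"
    using N by (intro sum_nonneg) (auto simp: is_norm_def)
  then have K: "0 < K" "(\<Sum>i\<in>UNIV. N (axis i (1::real) :: real ^ 'n)) \<le> K" by (auto simp: K_def)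
  define \<epsilon>' where "\<epsilon>' = \<epsilon> / K"
  have \<epsilon>': "0 < \<epsilon>'" using K \<epsilon> by (simp add: \<epsilon>'_def)
  define D where "D i T = {p \<in> P. wt l p < T \<and> \<epsilon>' * T < \<bar>wt (c i) p - Z (c i) / Z l * T\<bar>}" for i T
  have "thin (\<lambda>T. card (D i T))" for i
    unfolding D_def by (rule deviation[of "c i" "B i" \<epsilon>', OF c \<epsilon>'])
  then have "thin (\<lambda>T. \<Sum>i\<in>UNIV. card (D i T))" by (intro thin_sum) auto
  then show ?thesis
  proof (rule thin_mono)
    fix T :: real assume T: "0 < T"
    let ?c = "\<lambda>e. \<chi> i. c i e" and ?\<Lambda> = "\<chi> i. Z (c i) / Z l"
    let ?A = "{p \<in> P. wt l p < T \<and> (1 / T) *\<^sub>R wt ?c p \<in> {x. \<epsilon> < N (x - ?\<Lambda>)}}"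
    have fin: "finite (D i T)" for i
      by (rule finite_subset[OF _ finite_below[of T]]) (auto simp: D_def)
    have "?A \<subseteq> (\<Union>i. D i T)"
    proof
      fix p assume p: "p \<in> ?A"
      show "p \<in> (\<Union>i. D i T)"
      proof (rule ccontr)
        assume "p \<notin> (\<Union>i. D i T)"
        then have *: "\<bar>wt (c i) p - Z (c i) / Z l * T\<bar> \<le> \<epsilon>' * T" for i using p by (auto simp: D_def not_less)
        have "\<bar>((1 / T) *\<^sub>R wt ?c p - ?\<Lambda>) $ i\<bar> \<le> \<epsilon>'" for i
        proof -
          have "((1 / T) *\<^sub>R wt ?c p - ?\<Lambda>) $ i = (wt (c i) p - Z (c i) / Z l * T) / T"
            using T by (simp add: wt_vec_nth diff_divide_distrib)
          then show ?thesis using *[of i] T by (simp add: abs_divide pos_divide_le_eq)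
        qed
        then have "N ((1 / T) *\<^sub>R wt ?c p - ?\<Lambda>) \<le> \<epsilon>' * (\<Sum>i\<in>UNIV. N (axis i 1))"
          by (rule is_norm_bound[OF N])
        also have "\<dots> \<le> \<epsilon>' * K" using K \<epsilon>' by (intro mult_left_mono) auto
        also have "\<dots> = \<epsilon>" using K by (simp add: \<epsilon>'_def)
        finally show False using p by simp
      qed
    qed
    then have "card ?A \<le> card (\<Union>i. D i T)" using fin by (intro card_mono) auto
    also have "\<dots> \<le> (\<Sum>i\<in>UNIV. card (D i T))" by (rule card_UN_le) simp
    finally show "cnt ?c {x. \<epsilon> < N (x - ?\<Lambda>)} T \<le> (\<Sum>i\<in>UNIV. card (D i T))"
      unfolding cnt_def .
  qed
qed

lemma (in length_graph) path_measure_limit: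
  fixes c :: "'n::finite \<Rightarrow> 'e \<Rightarrow> real" and N :: "real ^ 'n \<Rightarrow> real"
  assumes c: "\<And>i e. e \<in> arcs G \<Longrightarrow> \<bar>c i e\<bar> \<le> B i * l e" "\<And>i. 0 \<le> B i"
    and N: "is_norm N" and \<epsilon>: "0 < \<epsilon>"
  shows "\<exists>L<0. ((\<lambda>T. ereal (1 / T) * elog (path_measure G l v T
      {p \<in> closed_paths G v. N ((1 / T) *\<^sub>R cost_vec c p - (\<chi> i. Z (c i) / Z l)) > \<epsilon>})) \<longlongrightarrow> L) at_top"
proof -
  let ?c = "\<lambda>e. \<chi> i. c i e" and ?U = "{x. \<epsilon> < N (x - (\<chi> i. Z (c i) / Z l))}"
  have "continuous_on UNIV (\<lambda>x. N (x - (\<chi> i. Z (c i) / Z l)))"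
    by (intro continuous_on_compose2[OF is_norm_continuous[OF N]] continuous_intros) auto
  then have U: "open ?U" by (intro open_Collect_less continuous_intros)
  have "cost_vec c p = wt ?c p" for p
    by (simp add: cost_vec_def awalk_cost_wt vec_eq_iff wt_vec_nth)
  then have "path_measure G l v T {p \<in> P. N ((1 / T) *\<^sub>R cost_vec c p - (\<chi> i. Z (c i) / Z l)) > \<epsilon>}
      = real (cnt ?c ?U T) / real (cnt ?c UNIV T)" for T
  proof -
    have "{p \<in> P. N ((1 / T) *\<^sub>R wt ?c p - (\<chi> i. Z (c i) / Z l)) > \<epsilon>} \<inter> {p \<in> P. wt l p < T}
        = {p \<in> P. wt l p < T \<and> (1 / T) *\<^sub>R wt ?c p \<in> ?U}" by auto
    then show ?thesis
      using \<open>\<And>p. cost_vec c p = wt ?c p\<close>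
      by (simp add: path_measure_def cnt_def closed_paths_below_def awalk_cost_wt)
  qed
  then show ?thesis using log_ratio_limit[OF U vector_deviation[OF c N \<epsilon>]] by simp
qed

theorem theorem2p5:
  fixes G :: "('v, 'e) pre_digraph"
    and l :: "'e \<Rightarrow> real"
    and v :: 'v
    and c :: "'n::finite \<Rightarrow> 'e \<Rightarrow> real"
  assumes "wf_digraph G"
    and "countable (verts G)"
    and "countable (arcs G)"
    and "\<And>e. e \<in> arcs G \<Longrightarrow> 0 < l e"
    and "G1 G l"
    and "G2 G l"
    and "G3 G l"
    and "v \<in> verts G"
    and "\<And>i. is_cost G l (c i)"
    and "\<And>i e. e \<in> arcs G \<Longrightarrow> 0 \<le> c i e"
  shows "\<exists>\<Lambda> :: real ^ 'n. (\<forall>i. 0 < \<Lambda> $ i) \<and>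
    (\<forall>N :: real ^ 'n \<Rightarrow> real. is_norm N \<longrightarrow>
      (\<forall>\<epsilon>>0. \<exists>L :: ereal. L < 0 \<and>
        ((\<lambda>T :: real. ereal (1 / T) *
            elog (path_measure G l v T
              {p \<in> closed_paths G v. N ((1 / T) *\<^sub>R cost_vec c p - \<Lambda>) > \<epsilon>}))
          \<longlongrightarrow> L) at_top))"
proof (cases "closed_paths G v = {}")
  case True
  \<comment> \<open>Without closed paths the measure is 0/0, which evaluates to 0, so the expression
    is \<open>-\<infinity>\<close> for every \<open>T > 0\<close> and any positive vector
    serves.\<close>
  have "((\<lambda>T. ereal (1 / T) * elog (path_measure G l v T
      {p \<in> closed_paths G v. N ((1 / T) *\<^sub>R cost_vec c p - (\<chi> i. 1)) > \<epsilon>})) \<longlongrightarrow> -\<infinity>) at_top"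
    for N :: "real ^ 'n \<Rightarrow> real" and \<epsilon>
    by (rule tendsto_eventually, use eventually_gt_at_top[of 0] in eventually_elim)
      (simp add: True path_measure_def elog_def)
  then show ?thesis by (intro exI[of _ "\<chi> i. 1"]) (auto intro!: exI[of _ "-\<infinity>"])
next
  case False
  interpret wf_digraph G by fact
  interpret length_graph G l v
    by unfold_locales (use assms False in auto)
  have "\<exists>C>0. \<forall>e\<in>arcs G. \<bar>c i e\<bar> \<le> C * l e" for i using assms(9) by (simp add: is_cost_def)
  then obtain B where B: "\<And>i. 0 < B i" "\<And>i e. e \<in> arcs G \<Longrightarrow> \<bar>c i e\<bar> \<le> B i * l e" by metis
  have "0 < Z (c i)" for i
  proof -
    obtain e where "e \<in> arcs G" "c i e \<noteq> 0" using assms(9)[of i] by (auto simp: is_cost_def)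
    then show ?thesis using B assms(10) by (intro Z_pos[of "c i" "B i" e]) (auto intro: less_imp_le)
  qed
  then have "\<forall>i. 0 < (\<chi> i. Z (c i) / Z l) $ i" using Z_l_pos by simp
  moreover have "\<exists>L<0. ((\<lambda>T. ereal (1 / T) * elog (path_measure G l v T
      {p \<in> closed_paths G v. N ((1 / T) *\<^sub>R cost_vec c p - (\<chi> i. Z (c i) / Z l)) > \<epsilon>})) \<longlongrightarrow> L) at_top"
    if "is_norm N" "0 < \<epsilon>" for N :: "real ^ 'n \<Rightarrow> real" and \<epsilon>
    using path_measure_limit[OF B(2) less_imp_le[OF B(1)] that] .
  ultimately show ?thesis by blast
qed

end
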